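(* Let $\mathcal{E}$ be the group of all interval exchange transformations of $[0,1)$. Let $r \in \mathcal{E}$ be conjugate in $\mathcal{E}$ to a disjoint rotation map, and let $g \in \mathcal{E}$ be an arbitrary interval exchange. Then the subgroup $\langle r, g \rangle$ of $\mathcal{E}$ generated by $r$ and $g$ is not isomorphic to the free group on two generators.
   Context: For $n \geq 1$ let $\Lambda_n = \{\lambda = (\lambda_1,\ldots,\lambda_n) \in \mathbb{R}^n : \lambda_i > 0,\ \sum_i \lambda_i = 1\}$. A vector $\lambda \in \Lambda_n$ induces a partition of $[0,1)$ into the half-open intervals $I_j = [\beta_{j-1}, \beta_j)$, $1 \leq j \leq n$, where $\beta_0 = 0$ and $\beta_j = \sum_{i=1}^{j} \lambda_i$. An interval exchange transformation (IET) is a bijection $[0,1) \to [0,1)$ obtained by partitioning $[0,1)$ into finitely many half-open subintervals and reordering them by translation. Precisely, for a permutation $\pi$ of $\{1,\ldots,n\}$ and $\lambda \in \Lambda_n$, the IET $f_{(\pi,\lambda)}$ is given by $f_{(\pi,\lambda)}(x) = x + \omega_j$ for $x \in I_j$, where $\omega_j = \sum_{i : \pi(i) < \pi(j)} \lambda_i - \sum_{i : i < j} \lambda_i$. The IETs are exactly the maps $f_{(\pi,\lambda)}$ for all $n$, $\pi$, $\lambda$. The set $\mathcal{E}$ of all IETs is a group under composition. Given $n \geq 1$, $\lambda \in \Lambda_n$ and $\alpha = (\alpha_1,\ldots,\alpha_n) \in (\mathbb{R}/\mathbb{Z})^n$, identified with $[0,1)^n$, the disjoint rotation map $r_{[\alpha,\lambda]}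 \in \mathcal{E}$ is defined, for each $1 \leq j \leq n$, by $$r_{[\alpha,\lambda]}(x) = \begin{cases} x + \lambda_j\alpha_j, & x \in [\beta_{j-1}, \beta_j - \lambda_j\alpha_j), \\ x + \lambda_j\alpha_j - \lambda_j, & x \in [\beta_j - \lambda_j\alpha_j, \beta_j). \end{cases}$$ A disjoint rotation map is an IET of the form $r_{[\alpha,\lambda]}$ for some $n$, $\lambda$, $\alpha$. *)

theory Defs
  imports
    Complex_Main
    "HOL-Combinatorics.Permutations"
    "HOL-Algebra.Bij"
    "HOL-Algebra.Generated_Groups"
begin

section \<open>Partitions of the unit interval\<close>

text \<open>
  Vectors indexed by \<open>1, \<dots>, n\<close> are functions on the naturals; only the values at the
  indices \<open>1, \<dots>, n\<close> matter.
\<close>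

definition Lambda :: "nat \<Rightarrow> (nat \<Rightarrow> real) set" where
  "Lambda n = {l. (\<forall>i\<in>{1..n}. l i > 0) \<and> (\<Sum>i=1..n. l i) = 1}"

definition beta :: "(nat \<Rightarrow> real) \<Rightarrow> nat \<Rightarrow> real" where
  "beta l j = (\<Sum>i=1..j. l i)"

definition part :: "(nat \<Rightarrow> real) \<Rightarrow> nat \<Rightarrow> real set" where
  "part l j = {beta l (j - 1)..<beta l j}"

definition part_index :: "nat \<Rightarrow> (nat \<Rightarrow> real) \<Rightarrow> real \<Rightarrow> nat" where
  "part_index n l x = (THE j. j \<in> {1..n} \<and> x \<in> part l j)"

lemma beta_mono:
  assumes "l \<in> Lambda n" "i \<le> j" "j \<le> n"
  shows "beta l i \<le> beta l j"
  unfolding beta_def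
proof (rule sum_mono2)
  show "{1..i} \<subseteq> {1..j}" using assms by auto
  fix b assume "b \<in> {1..j} - {1..i}"
  then have "b \<in> {1..n}" using assms by auto
  then show "0 \<le> l b" using assms(1) by (auto simp: Lambda_def intro: less_imp_le)
qed simp

lemma part_index_eq:
  assumes l: "l \<in> Lambda n" and j: "j \<in> {1..n}" and x: "x \<in> part l j"
  shows "part_index n l x = j"
  unfolding part_index_def
proof (rule the_equality)
  show "j \<in> {1..n} \<and> x \<in> part l j" using j x by simp
  fix k assume k: "k \<in> {1..n} \<and> x \<in> part l k"
  show "k = j"
  proof (rule ccontr)
    assume "k \<noteq> j"
    then consider "k \<le> j - 1" | "j \<le> k - 1" by linarith
    then show False
    proof cases
      case 1
      then have "beta l k \<le> beta l (j - 1)" using j by (intro beta_mono[OF l]) auto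
      then show False using k x by (simp add: part_def)
    next
      case 2
      then have "beta l j \<le> beta l (k - 1)" using k by (intro beta_mono[OF l]) auto
      then show False using k x by (simp add: part_def)
    qed
  qed
qed

lemma ex_part:
  assumes l: "l \<in> Lambda n" and x: "x \<in> {0..<1}"
  shows "\<exists>j\<in>{1..n}. x \<in> part l j"
proof -
  define j where "j = (LEAST j. x < beta l j)"
  have n: "x < beta l n" using l x by (simp add: Lambda_def beta_def)
  have j: "x < beta l j" unfolding j_def by (rule LeastI, rule n)
  have jn: "j \<le> n" unfolding j_def by (rule Least_le, rule n)
  have j0: "j \<noteq> 0" using j x by (auto simp: beta_def intro!: Nat.gr0I)
  have "\<not> x < beta l (j - 1)"
    using not_less_Least[of "j - 1" "\<lambda>j. x < beta l j"] j0 by (simp add: j_def)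
  then show ?thesis using j jn j0 by (intro bexI[of _ j]) (auto simp: part_def)
qed


section \<open>Interval exchange transformations and disjoint rotation maps\<close>

definition omega :: "nat \<Rightarrow> (nat \<Rightarrow> nat) \<Rightarrow> (nat \<Rightarrow> real) \<Rightarrow> nat \<Rightarrow> real" where
  "omega n p l j = (\<Sum>i\<in>{i\<in>{1..n}. p i < p j}. l i) - (\<Sum>i\<in>{i\<in>{1..n}. i < j}. l i)"

text \<open>
  Self-maps of \<open>[0,1)\<close> are extensional functions (\<open>undefined\<close> outside \<open>[0,1)\<close>),
  as required by \<^const>\<open>BijGroup\<close>.
\<close>

definition iet :: "nat \<Rightarrow> (nat \<Rightarrow> nat) \<Rightarrow> (nat \<Rightarrow> real) \<Rightarrow> real \<Rightarrow> real" where
  "iet n p l = (\<lambda>x\<in>{0..<1}. x + omega n p l (part_index n l x))"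

definition IETs :: "(real \<Rightarrow> real) set" where
  "IETs = {iet n p l | n p l. n \<ge> 1 \<and> p permutes {1..n} \<and> l \<in> Lambda n}"

definition IET_group :: "(real \<Rightarrow> real) monoid" where
  "IET_group = (BijGroup {0..<1}) \<lparr>carrier := IETs\<rparr>"

definition disjoint_rotation ::
    "nat \<Rightarrow> (nat \<Rightarrow> real) \<Rightarrow> (nat \<Rightarrow> real) \<Rightarrow> real \<Rightarrow> real" where
  "disjoint_rotation n a l = (\<lambda>x\<in>{0..<1}.
     let j = part_index n l x in
       if x < beta l j - l j * a j then x + l j * a j else x + l j * a j - l j)"

definition disjoint_rotations :: "(real \<Rightarrow> real) set" where
  "disjoint_rotations =
     {disjoint_rotation n a l | n a l. n \<ge> 1 \<and> (\<forall>j\<in>{1..n}. a j \<in> {0..<1}) \<and> l \<in> Lambda n}"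

lemma part_subset:
  assumes l: "l \<in> Lambda n" and j: "j \<in> {1..n}"
  shows "part l j \<subseteq> {0..<1}"
proof -
  have "beta l 0 \<le> beta l (j - 1)" using j by (intro beta_mono[OF l]) auto
  then have "0 \<le> beta l (j - 1)" by (simp add: beta_def)
  moreover have "beta l j \<le> 1"
    using beta_mono[OF l, of j n] j l by (simp add: beta_def Lambda_def)
  ultimately show ?thesis by (auto simp: part_def)
qed

lemma iet_apply:
  assumes "l \<in> Lambda n" "j \<in> {1..n}" "x \<in> part l j"
  shows "iet n p l x = x + omega n p l j"
  using assms part_subset[of l n j] by (auto simp: iet_def part_index_eq)

lemma disjoint_rotation_apply:
  assumes "l \<in> Lambda n" "j \<in> {1..n}" "x \<in> part l j"
  shows "disjoint_rotation n a l x =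
    (if x \<in> {beta l (j - 1)..<beta l j - l j * a j} then x + l j * a j
     else x + l j * a j - l j)"
  using assms part_subset[of l n j]
  by (auto simp: disjoint_rotation_def part_index_eq part_def)

definition conjugate_in :: "('a, 'b) monoid_scheme \<Rightarrow> 'a \<Rightarrow> 'a \<Rightarrow> bool" where
  "conjugate_in G x y \<longleftrightarrow> (\<exists>h\<in>carrier G. x = h \<otimes>\<^bsub>G\<^esub> y \<otimes>\<^bsub>G\<^esub> inv\<^bsub>G\<^esub> h)"


section \<open>Free groups\<close>

text \<open>
  The free group on \<open>S\<close> consists of the reduced words in the letters \<open>(s, True)\<close>, which stands
  for \<open>s\<close>, and \<open>(s, False)\<close>, which stands for the inverse of \<open>s\<close>. The product is the reduced
  form of the concatenation.
\<close>

definition opp :: "'a \<times> bool \<Rightarrow> 'a \<times> bool" where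
  "opp x = (fst x, \<not> snd x)"

fun reduced :: "('a \<times> bool) list \<Rightarrow> bool" where
  "reduced (x # y # w) \<longleftrightarrow> y \<noteq> opp x \<and> reduced (y # w)"
| "reduced _ \<longleftrightarrow> True"

fun cancel_cons :: "'a \<times> bool \<Rightarrow> ('a \<times> bool) list \<Rightarrow> ('a \<times> bool) list" where
  "cancel_cons x [] = [x]"
| "cancel_cons x (y # w) = (if y = opp x then w else x # y # w)"

definition free_group :: "'a set \<Rightarrow> ('a \<times> bool) list monoid" where
  "free_group S =
     \<lparr>carrier = {w. reduced w \<and> fst ` set w \<subseteq> S},
      mult = \<lambda>u v. foldr cancel_cons u v,
      one = []\<rparr>"

lemma opp_opp [simp]: "opp (opp x) = x"
  by (simp add: opp_def)

lemma opp_neq [simp]: "opp x \<noteq> x" "x \<noteq> opp x"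
  by (auto simp: opp_def prod_eq_iff)

lemma fst_opp [simp]: "fst (opp x) = fst x"
  by (simp add: opp_def)

lemma reduced_tl: "reduced (x # w) \<Longrightarrow> reduced w"
  by (cases w) auto

lemma reduced_cancel_cons: "reduced w \<Longrightarrow> reduced (cancel_cons x w)"
  by (cases w) (auto dest: reduced_tl)

lemma cancel_cons_reduced: "reduced (x # w) \<Longrightarrow> cancel_cons x w = x # w"
  by (cases w) auto

lemma cancel_cons_opp: "reduced w \<Longrightarrow> cancel_cons (opp x) (cancel_cons x w) = w"
  by (cases w) (auto dest: cancel_cons_reduced)

lemma set_cancel_cons: "set (cancel_cons x w) \<subseteq> insert x (set w)"
  by (cases w) auto

lemma reduced_mult: "reduced v \<Longrightarrow> reduced (foldr cancel_cons u v)"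
  by (induction u) (auto intro: reduced_cancel_cons)

lemma set_mult: "set (foldr cancel_cons u v) \<subseteq> set u \<union> set v"
  by (induction u) (use set_cancel_cons in fastforce)+

lemma mult_cancel_cons:
  assumes "reduced w"
  shows "foldr cancel_cons (cancel_cons x u) w = cancel_cons x (foldr cancel_cons u w)"
proof (cases u)
  case (Cons y u')
  show ?thesis
  proof (cases "y = opp x")
    case True
    then show ?thesis
      using Cons cancel_cons_opp[of "foldr cancel_cons u' w" "opp x"] reduced_mult[OF assms]
      by simp
  qed (simp add: Cons)
qed simp

lemma word_mult_assoc:
  assumes "reduced w"
  shows "foldr cancel_cons (foldr cancel_cons u v) w = foldr cancel_cons u (foldr cancel_cons v w)"
  by (induction u) (simp_all add: mult_cancel_cons[OF assms])

lemma mult_Nil: "reduced w \<Longrightarrow> foldr cancel_cons w [] = w"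
  proof (induction w)
  case (Cons x w)
  then show ?case using reduced_tl[OF Cons.prems] by (simp add: cancel_cons_reduced)
qed simp

lemma left_inverse:
  assumes "reduced w"
  shows "foldr cancel_cons (foldr cancel_cons (rev (map opp w)) []) w = []"
proof -
  have "foldr cancel_cons (rev (map opp w)) w = []"
    using assms
  proof (induction w)
    case (Cons x w)
    then show ?case
      using reduced_tl[OF Cons.prems] by simp
  qed simp
  then show ?thesis using word_mult_assoc[OF assms, of "rev (map opp w)" "[]"] by simp
qed

lemma group_free_group: "group (free_group S)"
proof (rule groupI)
  fix w assume w: "w \<in> carrier (free_group S)"
  let ?v = "foldr cancel_cons (rev (map opp w)) []"
  have "fst ` set ?v \<subseteq> fst ` set (rev (map opp w))"
    using set_mult[of "rev (map opp w)" "[]"] by (intro image_mono) simp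
  also have "\<dots> = fst ` set w" by (simp add: image_image)
  finally have "?v \<in> carrier (free_group S)"
    using w by (auto simp: free_group_def reduced_mult)
  then show "\<exists>v\<in>carrier (free_group S). v \<otimes>\<^bsub>free_group S\<^esub> w = \<one>\<^bsub>free_group S\<^esub>"
    using w left_inverse[of w] by (intro bexI[of _ ?v]) (auto simp: free_group_def)
next
  fix u v assume "u \<in> carrier (free_group S)" "v \<in> carrier (free_group S)"
  then show "u \<otimes>\<^bsub>free_group S\<^esub> v \<in> carrier (free_group S)"
    using set_mult[of u v] by (fastforce simp: free_group_def reduced_mult)
qed (auto simp: free_group_def word_mult_assoc)

text \<open>The universal property of the free group.\<close>

lemma free_group_extend:
  assumes "group G" and f: "f \<in> S \<rightarrow> carrier G"
  shows "\<exists>h\<in>hom (free_group S) G. \<forall>s\<in>S. h [(s, True)] = f s"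
proof -
  interpret group G by fact
  define val where "val = (\<lambda>x. if snd x then f (fst x) else inv\<^bsub>G\<^esub> f (fst x))"
  define h where "h = (\<lambda>w. foldr (\<lambda>x y. val x \<otimes>\<^bsub>G\<^esub> y) w \<one>\<^bsub>G\<^esub>)"
  have val: "val x \<in> carrier G" if "fst x \<in> S" for x
    using that f by (auto simp: val_def)
  have val_opp: "val x \<otimes>\<^bsub>G\<^esub> val (opp x) = \<one>\<^bsub>G\<^esub>" if "fst x \<in> S" for x
    using that f by (auto simp: val_def opp_def Pi_def)
  have h: "h w \<in> carrier G" if "fst ` set w \<subseteq> S" for w
    using that by (induction w) (auto simp: h_def val)
  have cc: "h (cancel_cons x w) = val x \<otimes>\<^bsub>G\<^esub> h w" if x: "fst x \<in> S" and w: "fst ` set w \<subseteq> S" for x w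
  proof (cases w)
    case (Cons y w')
    show ?thesis
    proof (cases "y = opp x")
      case True
      have "val x \<otimes>\<^bsub>G\<^esub> h w = val x \<otimes>\<^bsub>G\<^esub> (val (opp x) \<otimes>\<^bsub>G\<^esub> h w')"
        using Cons True by (simp add: h_def)
      also have "\<dots> = (val x \<otimes>\<^bsub>G\<^esub> val (opp x)) \<otimes>\<^bsub>G\<^esub> h w'"
        using x w Cons by (intro m_assoc[symmetric] val h) auto
      also have "\<dots> = h w'" using x w Cons by (simp add: val_opp h)
      finally show ?thesis using Cons True by simp
    qed (simp add: Cons h_def)
  qed (simp add: h_def)
  have mult: "h (foldr cancel_cons u v) = h u \<otimes>\<^bsub>G\<^esub> h v"
    if "fst ` set u \<subseteq> S" "fst ` set v \<subseteq> S" for u v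
    using that
  proof (induction u)
    case Nil
    then show ?case using h by (simp add: h_def)
  next
    case (Cons x u)
    have "fst ` set (foldr cancel_cons u v) \<subseteq> S"
      using set_mult[of u v] Cons.prems by fastforce
    then have "h (foldr cancel_cons (x # u) v) = val x \<otimes>\<^bsub>G\<^esub> (h u \<otimes>\<^bsub>G\<^esub> h v)"
      using Cons by (simp add: cc)
    also have "\<dots> = (val x \<otimes>\<^bsub>G\<^esub> h u) \<otimes>\<^bsub>G\<^esub> h v"
      using Cons.prems by (intro m_assoc[symmetric] val h) auto
    finally show ?case by (simp add: h_def)
  qed
  have "h \<in> hom (free_group S) G"
    by (auto simp: hom_def free_group_def h mult)
  moreover have "h [(s, True)] = f s" if "s \<in> S" for s
    using funcset_mem[OF f that] by (simp add: h_def val_def)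
  ultimately show ?thesis by blast
qed

lemma free_group_generated:
  "generate (free_group S) ((\<lambda>s. [(s, True)]) ` S) = carrier (free_group S)"
proof -
  interpret F: group "free_group S" by (rule group_free_group)
  let ?B = "(\<lambda>s. [(s, True)]) ` S"
  have B: "?B \<subseteq> carrier (free_group S)" by (auto simp: free_group_def)
  have inv: "inv\<^bsub>free_group S\<^esub> [(s, True)] = [(s, False)]" if "s \<in> S" for s
    using that by (intro F.inv_equality) (auto simp: free_group_def opp_def)
  have letter: "[x] \<in> generate (free_group S) ?B" if "fst x \<in> S" for x
  proof (cases "snd x")
    case True
    then show ?thesis using that by (intro generate.incl) (auto simp: prod_eq_iff image_iff)
  next
    case False
    then have "[x] = inv\<^bsub>free_group S\<^esub> [(fst x, True)]" using inv[OF that] by (simp add: prod_eq_iff)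
    then show ?thesis using that by (metis generate.inv imageI)
  qed
  have "w \<in> generate (free_group S) ?B" if "reduced w" "fst ` set w \<subseteq> S" for w
    using that
  proof (induction w)
    case Nil
    then show ?case using generate.one[of "free_group S" ?B] by (simp add: free_group_def)
  next
    case (Cons x w)
    have "[x] \<otimes>\<^bsub>free_group S\<^esub> w \<in> generate (free_group S) ?B"
      using Cons reduced_tl[OF Cons.prems(1)] by (intro generate.eng letter) auto
    then show ?case using Cons.prems by (simp add: free_group_def cancel_cons_reduced)
  qed
  then show ?thesis using F.generate_incl[OF B] by (auto simp: free_group_def)
qed

end

(*
  The idea is to write down a law that r and g satisfy although a free basis could not.

  Let r be conjugate to a disjoint rotation. A suitable power A of r fixes the rational circles
  of r pointwise, and by Dirichlet's theorem some powers A^n with n > 0 move every point, off a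
  neighbourhood of a finite set D, by a small locally constant amount. The same holds for the
  conjugate B = g^-1 A g. Small locally constant translations commute, so for suitable n and m
  the support of c = [A^n, B^m] lies close to D; more precisely, close to the one-sided germs at
  points of D which A or B moves. Such germs have infinite orbits, so some w = A^i B^j carries
  all of them away from one another. Then c and w c w^-1 have disjoint supports and commute.
  This can be done for two different i and a common j.

  In a free group commuting is transitive on nontrivial elements, and x commutes with g
  whenever it commutes with g x g^-1. Hence c, if it is nontrivial, commutes with both w, so
  with a power of A, so with A and B; hence A and B commute, and then so do r and g. The
  properties of the free group are read off from an embedding into the unit quaternions.
*)
theory Submission
  imports
    "HOL-Analysis.Kronecker_Approximation_Theorem"
    "HOL-Computational_Algebra.Primes"
    Defs
begin

section \<open>Groups with malnormal centralizers\<close>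

text \<open>The order of the choices matters. The exponents in w are found first, from the germs
  alone, and give a set U around the moved germs with w(U) disjoint from U. Only then is the size
  \<epsilon> of the small translations fixed, and n and m come last.

  Germs are one-sided because an exchange can fix the points just left of d and move those just
  right of it. The power N is taken because germs on rational circles have finite orbits and could
  not be displaced; once A and B both fix a germ, c fixes its points and nothing has to be
  displaced.

  A single w is not enough: c commuting with A^i B^j alone is no contradiction, as the two may be
  powers of one element. Exponents i < k with the same j isolate A^(k-i).\<close>

lemma (in group) conj_pow:
  assumes "h \<in> carrier G" "s \<in> carrier G"
  shows "(h \<otimes> s \<otimes> inv h) [^] (k :: nat) = h \<otimes> s [^] k \<otimes> inv h"
proof (induction k)
  case (Suc k)
  have "inv h \<otimes> (h \<otimes> (s \<otimes> inv h)) = s \<otimes> inv h"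
    using assms by (simp add: m_assoc[symmetric])
  then show ?case using assms Suc by (simp add: m_assoc)
qed (use assms in simp)

text \<open>Centralizers are subgroups: those of \<open>a\<close> and \<open>b\<close> contain x, so
  that of x contains both generators and therefore y.\<close>

lemma (in group) generate_pair_commute:
  assumes ab: "a \<in> carrier G" "b \<in> carrier G" "a \<otimes> b = b \<otimes> a"
    and x: "x \<in> generate G {a, b}" and y: "y \<in> generate G {a, b}"
  shows "x \<otimes> y = y \<otimes> x"
proof -
  have sub: "subgroup {z \<in> carrier G. z \<otimes> c = c \<otimes> z} G" if c: "c \<in> carrier G" for c
  proof (rule subgroupI)
    show "{z \<in> carrier G. z \<otimes> c = c \<otimes> z} \<noteq> {}" using c by (auto intro!: exI[of _ \<one>])
  next
    fix z assume "z \<in> {z \<in> carrier G. z \<otimes> c = c \<otimes> z}"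
    then have z: "z \<in> carrier G" "z \<otimes> c = c \<otimes> z" by auto
    have "inv z \<otimes> c = inv z \<otimes> (c \<otimes> z) \<otimes> inv z" using z c by (simp add: m_assoc)
    also have "\<dots> = inv z \<otimes> (z \<otimes> c) \<otimes> inv z" using z by simp
    also have "\<dots> = c \<otimes> inv z" using z(1) c by (simp add: m_assoc[symmetric])
    finally show "inv z \<in> {z \<in> carrier G. z \<otimes> c = c \<otimes> z}" using z by simp
  next
    fix z z' assume "z \<in> {z \<in> carrier G. z \<otimes> c = c \<otimes> z}" "z' \<in> {z \<in> carrier G. z \<otimes> c = c \<otimes> z}"
    then have z: "z \<in> carrier G" "z \<otimes> c = c \<otimes> z" "z' \<in> carrier G" "z' \<otimes> c = c \<otimes> z'" by auto
    have "z \<otimes> z' \<otimes> c = (z \<otimes> c) \<otimes> z'" using z(1,3,4) c by (simp add: m_assoc)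
    also have "\<dots> = c \<otimes> (z \<otimes> z')" unfolding z(2) by (rule m_assoc[OF c z(1,3)])
    finally show "z \<otimes> z' \<in> {z \<in> carrier G. z \<otimes> c = c \<otimes> z}" using z by simp
  qed auto
  have gen: "generate G {a, b} \<subseteq> {z \<in> carrier G. z \<otimes> c = c \<otimes> z}"
    if "c \<in> carrier G" "a \<otimes> c = c \<otimes> a" "b \<otimes> c = c \<otimes> b" for c
    using that ab by (intro generate_subgroup_incl[OF _ sub]) auto
  have xc: "x \<in> carrier G" using x generate_incl[of "{a, b}"] ab by blast
  have "a \<otimes> x = x \<otimes> a" "b \<otimes> x = x \<otimes> b"
    using gen[of a] gen[of b] x ab by auto
  then have "y \<otimes> x = x \<otimes> y" using gen[OF xc] y by blast
  then show ?thesis by simp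
qed

text \<open>For moving the commutator and its conjugates, which first arise as arbitrary bijections
  of the interval, into the subgroup generated by \<open>r\<close> and \<open>g\<close>.\<close>

lemma (in group) subgroup_left_factor_mem:
  assumes H: "subgroup H G" and x: "x \<in> carrier G" and y: "y \<in> H" and xy: "x \<otimes> y \<in> H"
  shows "x \<in> H"
proof -
  interpret H: subgroup H G by (rule H)
  have "(x \<otimes> y) \<otimes> inv y \<in> H" using xy y by simp
  then show ?thesis using x H.mem_carrier[OF y] by (simp add: m_assoc)
qed

lemma (in subgroup) nat_pow_mem:
  assumes "group G" "x \<in> H"
  shows "x [^] (n :: nat) \<in> H"
  using assms by (induction n) (auto simp: group.is_monoid monoid.nat_pow_Suc)

text \<open>The name is for conjugately separated abelian. The conjugation y = g x g^-1 is written g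
  x = y g, so that homomorphisms carry the condition over without touching inverses.\<close>

locale csa_group = group +
  assumes torsion_free: "x \<in> carrier G \<Longrightarrow> 0 < n \<Longrightarrow> x [^] (n :: nat) = \<one> \<Longrightarrow> x = \<one>"
    and commute_trans: "x \<in> carrier G \<Longrightarrow> y \<in> carrier G \<Longrightarrow> z \<in> carrier G \<Longrightarrow> x \<noteq> \<one> \<Longrightarrow>
      x \<otimes> y = y \<otimes> x \<Longrightarrow> x \<otimes> z = z \<otimes> x \<Longrightarrow> y \<otimes> z = z \<otimes> y"
    and conj_separated: "x \<in> carrier G \<Longrightarrow> y \<in> carrier G \<Longrightarrow> g \<in> carrier G \<Longrightarrow>
      g \<otimes> x = y \<otimes> g \<Longrightarrow> x \<otimes> y = y \<otimes> x \<Longrightarrow> g \<otimes> x = x \<otimes> g"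
begin

lemma commute_pow:
  assumes "x \<in> carrier G" "y \<in> carrier G" "x \<otimes> y = y \<otimes> x"
  shows "x [^] (n :: nat) \<otimes> y = y \<otimes> x [^] n"
proof (induction n)
  case (Suc n)
  then show ?case using assms by (simp add: m_assoc) (simp add: m_assoc [symmetric])
qed (use assms in simp)

lemma commute_root:
  assumes x: "x \<in> carrier G" and y: "y \<in> carrier G" and n: "0 < (n :: nat)"
    and c: "x [^] n \<otimes> y = y \<otimes> x [^] n"
  shows "x \<otimes> y = y \<otimes> x"
proof (cases "x = \<one>")
  case False
  then have "x [^] n \<noteq> \<one>" using torsion_free x n by blast
  then show ?thesis
    using commute_trans[of "x [^] n" x y] commute_pow[of x x n] x y c by simp
qed (use y in simp)

lemma commute_cancel_right:
  assumes "x \<in> carrier G" "y \<in> carrier G" "c \<in> carrier G"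
    and "c \<otimes> (x \<otimes> y) = (x \<otimes> y) \<otimes> c" "c \<otimes> y = y \<otimes> c"
  shows "c \<otimes> x = x \<otimes> c"
proof -
  have "(c \<otimes> x) \<otimes> y = (x \<otimes> c) \<otimes> y" using assms by (simp add: m_assoc)
  then show ?thesis using assms by simp
qed

lemma commute_cancel_left:
  assumes "x \<in> carrier G" "y \<in> carrier G" "c \<in> carrier G"
    and "c \<otimes> (x \<otimes> y) = (x \<otimes> y) \<otimes> c" "c \<otimes> x = x \<otimes> c"
  shows "c \<otimes> y = y \<otimes> c"
proof -
  have "x \<otimes> (c \<otimes> y) = x \<otimes> (y \<otimes> c)" using assms by (simp add: m_assoc [symmetric])
  then show ?thesis using assms by simp
qed

text \<open>\<open>c\<close> is the commutator of \<open>A^n\<close> and \<open>B^m\<close>, and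
  \<open>d\<close>, \<open>d'\<close> are its conjugates by \<open>w\<close>, \<open>w'\<close>.
  Equations without inverses make the lemma applicable in a subgroup once products and powers are
  identified with those of the ambient group.\<close>

lemma commutator_law_imp_commute:
  fixes N n m i j k :: nat
  assumes carr: "r \<in> carrier G" "g \<in> carrier G" "y \<in> carrier G" "c \<in> carrier G"
      "d \<in> carrier G" "d' \<in> carrier G"
    and y: "g \<otimes> y = r \<otimes> g"
    and A: "A = r [^] N" and B: "B = y [^] N"
    and c: "c \<otimes> (B [^] m \<otimes> A [^] n) = A [^] n \<otimes> B [^] m"
    and w: "w = A [^] i \<otimes> B [^] j" and w': "w' = A [^] k \<otimes> B [^] j"
    and d: "w \<otimes> c = d \<otimes> w" "c \<otimes> d = d \<otimes> c"
    and d': "w' \<otimes> c = d' \<otimes> w'" "c \<otimes> d' = d' \<otimes> c"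
    and pos: "0 < N" "0 < n" "0 < m" "0 < j" "i < k"
  shows "r \<otimes> g = g \<otimes> r"
proof (rule ccontr)
  assume ne: "r \<otimes> g \<noteq> g \<otimes> r"
  have AB: "A \<in> carrier G" "B \<in> carrier G" "w \<in> carrier G" "w' \<in> carrier G"
    using carr by (auto simp: A B w w')
  \<comment> \<open>\<open>y\<close> is a conjugate of \<open>r\<close>; if the two commuted,
    separation would make \<open>g\<close> centralize \<open>y\<close>, so that
    \<open>y = r\<close>.\<close>
  have ry: "r \<otimes> y \<noteq> y \<otimes> r"
  proof
    assume "r \<otimes> y = y \<otimes> r"
    then have "g \<otimes> y = y \<otimes> g" using conj_separated[of y r g] carr y by simp
    then have "y = r" using y carr by simp
    then show False using y ne by simp
  qed
  have AB_ne: "A \<otimes> B \<noteq> B \<otimes> A"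
  proof
    assume "A \<otimes> B = B \<otimes> A"
    then have "r \<otimes> B = B \<otimes> r" using commute_root[of r B N] carr AB pos by (simp add: A)
    then have "y \<otimes> r = r \<otimes> y" using commute_root[of y r N] carr AB pos by (simp add: B)
    then show False using ry by simp
  qed
  have "c \<noteq> \<one>"
  proof
    assume "c = \<one>"
    then have "A [^] n \<otimes> B [^] m = B [^] m \<otimes> A [^] n" using c AB by simp
    then have "A \<otimes> B [^] m = B [^] m \<otimes> A" using commute_root[of A "B [^] m" n] AB pos by simp
    then have "B \<otimes> A = A \<otimes> B" using commute_root[of B A m] AB pos by simp
    then show False using AB_ne by simp
  qed
  have cw: "c \<otimes> w = w \<otimes> c" using conj_separated[of c d w] d AB carr by simp
  have cw': "c \<otimes> w' = w' \<otimes> c" using conj_separated[of c d' w'] d' AB carr by simp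
  \<comment> \<open>The common right factor \<open>B^j\<close> makes the quotient of the two words a
    pure power of \<open>A\<close>.\<close>
  have "w' = A [^] (k - i) \<otimes> w"
    using AB pos by (simp add: w w' m_assoc[symmetric] nat_pow_mult)
  then have "c \<otimes> A [^] (k - i) = A [^] (k - i) \<otimes> c"
    using commute_cancel_right[of "A [^] (k - i)" w c] cw cw' AB carr by simp
  then have Ac: "A \<otimes> c = c \<otimes> A" using commute_root[of A c "k - i"] AB carr pos by simp
  have "c \<otimes> A [^] i = A [^] i \<otimes> c" using commute_pow[of A c i] AB carr Ac by simp
  then have "c \<otimes> B [^] j = B [^] j \<otimes> c"
    using commute_cancel_left[of "A [^] i" "B [^] j" c] cw AB carr by (simp add: w)
  then have "B \<otimes> c = c \<otimes> B" using commute_root[of B c j] AB carr pos by simp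
  then show False using commute_trans[of c A B] Ac \<open>c \<noteq> \<one>\<close> AB carr AB_ne by simp
qed

end

text \<open>Each condition is an implication between equations and inequations of products and
  powers, which an injective homomorphism preserves and reflects.\<close>

lemma csa_group_mon:
  assumes "csa_group H" "group G" and h: "h \<in> hom G H" "inj_on h (carrier G)"
  shows "csa_group G"
proof -
  interpret H: csa_group H by fact
  interpret G: group G by fact
  interpret h: group_hom G H h by unfold_locales (use h in auto)
  have eq: "x = y" if "h x = h y" "x \<in> carrier G" "y \<in> carrier G" for x y
    using that h(2) by (auto dest: inj_onD)
  have comm: "x \<otimes>\<^bsub>G\<^esub> y = z \<otimes>\<^bsub>G\<^esub> w \<longleftrightarrow> h x \<otimes>\<^bsub>H\<^esub> h y = h z \<otimes>\<^bsub>H\<^esub> h w"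
    if "x \<in> carrier G" "y \<in> carrier G" "z \<in> carrier G" "w \<in> carrier G" for x y z w
    using that eq[of "x \<otimes>\<^bsub>G\<^esub> y" "z \<otimes>\<^bsub>G\<^esub> w"] by (metis G.m_closed h.hom_mult)
  show ?thesis
  proof
    fix x and n :: nat
    assume "x \<in> carrier G" "0 < n" "x [^]\<^bsub>G\<^esub> n = \<one>\<^bsub>G\<^esub>"
    then show "x = \<one>\<^bsub>G\<^esub>" using H.torsion_free[of "h x" n] eq[of x "\<one>\<^bsub>G\<^esub>"]
      by (metis G.one_closed h.hom_closed h.hom_nat_pow h.hom_one)
  next
    fix x y z
    assume "x \<in> carrier G" "y \<in> carrier G" "z \<in> carrier G" "x \<noteq> \<one>\<^bsub>G\<^esub>"
      "x \<otimes>\<^bsub>G\<^esub> y = y \<otimes>\<^bsub>G\<^esub> x" "x \<otimes>\<^bsub>G\<^esub> z = z \<otimes>\<^bsub>G\<^esub> x"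
    then show "y \<otimes>\<^bsub>G\<^esub> z = z \<otimes>\<^bsub>G\<^esub> y"
      using H.commute_trans[of "h x" "h y" "h z"] eq[of x "\<one>\<^bsub>G\<^esub>"] by (auto simp: comm)
  next
    fix x y g
    assume "x \<in> carrier G" "y \<in> carrier G" "g \<in> carrier G"
      "g \<otimes>\<^bsub>G\<^esub> x = y \<otimes>\<^bsub>G\<^esub> g" "x \<otimes>\<^bsub>G\<^esub> y = y \<otimes>\<^bsub>G\<^esub> x"
    then show "g \<otimes>\<^bsub>G\<^esub> x = x \<otimes>\<^bsub>G\<^esub> g"
      using H.conj_separated[of "h x" "h y" "h g"] by (auto simp: comm)
  qed
qed

section \<open>The free group of rank two\<close>

lemma reduced_append:
  "reduced (u @ v) \<longleftrightarrow>
     reduced u \<and> reduced v \<and> (u = [] \<or> v = [] \<or> hd v \<noteq> opp (last u))"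
proof (induction u)
  case (Cons x u)
  then show ?case by (cases u; cases v) auto
qed simp

lemma foldr_cancel_cons_reduced: "reduced (u @ v) \<Longrightarrow> foldr cancel_cons u v = u @ v"
proof (induction u)
  case (Cons x u)
  then show ?case using reduced_tl[of x "u @ v"] by (simp add: cancel_cons_reduced)
qed simp

text \<open>With no cancellation at the junctions a power keeps \<open>w\<close> as a prefix, so it
  is nonempty. The clause on \<open>last\<close> lets the induction append one more copy.\<close>

lemma free_group_pow_cyclically_reduced:
  assumes w: "w \<in> carrier (free_group S)" "w \<noteq> []" "hd w \<noteq> opp (last w)"
  shows "\<exists>v. w [^]\<^bsub>free_group S\<^esub> Suc n = w @ v \<and> reduced (w @ v) \<and> last (w @ v) = last w"
proof (induction n)
  case 0
  then show ?case using w group.is_monoid[OF group_free_group]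
    by (intro exI[of _ "[]"]) (auto simp: free_group_def mult_Nil foldr_cancel_cons_reduced)
next
  case (Suc n)
  then obtain v where v: "w [^]\<^bsub>free_group S\<^esub> Suc n = w @ v" "reduced (w @ v)" "last (w @ v) = last w"
    by blast
  have red: "reduced ((w @ v) @ w)"
    unfolding reduced_append[of "w @ v"] using v w by (simp add: free_group_def)
  have "w [^]\<^bsub>free_group S\<^esub> Suc (Suc n) = (w @ v) \<otimes>\<^bsub>free_group S\<^esub> w"
    using v(1) by simp
  also have "\<dots> = foldr cancel_cons (w @ v) w" by (simp add: free_group_def)
  also have "\<dots> = w @ (v @ w)"
    using foldr_cancel_cons_reduced[OF red] by simp
  finally show ?case using red w by (intro exI[of _ "v @ w"]) simp
qed

text \<open>A word that begins and ends in inverse letters is a conjugate of a shorter word of the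
  same order; stripping such letters leads to the cyclically reduced case.\<close>

lemma free_group_torsion_free:
  assumes "w \<in> carrier (free_group S)" "0 < n" "w [^]\<^bsub>free_group S\<^esub> (n :: nat) = \<one>\<^bsub>free_group S\<^esub>"
  shows "w = \<one>\<^bsub>free_group S\<^esub>"
  using assms
proof (induction w rule: length_induct)
  case (1 w)
  interpret F: group "free_group S" by (rule group_free_group)
  obtain k where n: "n = Suc k" using 1 by (cases n) auto
  show ?case
  proof (rule ccontr)
    assume "w \<noteq> \<one>\<^bsub>free_group S\<^esub>"
    then have ne: "w \<noteq> []" by (simp add: free_group_def)
    show False
    proof (cases "hd w = opp (last w)")
      case False
      then show False using free_group_pow_cyclically_reduced[OF "1.prems"(1) ne False, of k] 1 n ne
        by (auto simp: free_group_def)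
    next
      case True
      obtain x u where xu: "w = x # u" using ne by (cases w) auto
      have "u \<noteq> []" using True xu by auto
      then obtain v where v: "w = x # v @ [opp x]"
        using True xu by (metis append_butlast_last_id last_ConsR list.sel(1) opp_opp)
      let ?x = "[x]" and ?y = "[opp x]"
      have carr: "?x \<in> carrier (free_group S)" "?y \<in> carrier (free_group S)"
        using "1.prems"(1) v by (auto simp: free_group_def)
      have red: "reduced (x # v)" "reduced (v @ [opp x])"
        using "1.prems"(1) v reduced_append[of "x # v" "[opp x]"] reduced_tl[of x "v @ [opp x]"]
        by (auto simp: free_group_def)
      have vc: "v \<in> carrier (free_group S)"
        using "1.prems"(1) v red(1) reduced_tl[of x v] by (auto simp: free_group_def)
      have inv: "inv\<^bsub>free_group S\<^esub> ?x = ?y"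
        using carr by (intro F.inv_equality) (auto simp: free_group_def)
      have w: "w = ?x \<otimes>\<^bsub>free_group S\<^esub> v \<otimes>\<^bsub>free_group S\<^esub> ?y"
        using v red "1.prems"(1) foldr_cancel_cons_reduced[of "x # v" "[opp x]"] 
          foldr_cancel_cons_reduced[of "[x]" v] by (simp add: free_group_def cancel_cons_reduced)
      have pow: "w [^]\<^bsub>free_group S\<^esub> n = ?x \<otimes>\<^bsub>free_group S\<^esub> v [^]\<^bsub>free_group S\<^esub> n \<otimes>\<^bsub>free_group S\<^esub> ?y"
        for n :: nat
      proof (induction n)
        case 0
        then show ?case using carr F.r_inv[of ?x] inv by simp
      next
        case (Suc n)
        have "w [^]\<^bsub>free_group S\<^esub> Suc n = ?x \<otimes>\<^bsub>free_group S\<^esub> v [^]\<^bsub>free_group S\<^esub> n \<otimes>\<^bsub>free_group S\<^esub>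
           ((?y \<otimes>\<^bsub>free_group S\<^esub> ?x) \<otimes>\<^bsub>free_group S\<^esub> (v \<otimes>\<^bsub>free_group S\<^esub> ?y))"
          using Suc carr vc by (simp add: w F.m_assoc)
        also have "?y \<otimes>\<^bsub>free_group S\<^esub> ?x = \<one>\<^bsub>free_group S\<^esub>"
          using carr F.l_inv[of ?x] inv by simp
        finally show ?case using carr vc by (simp add: F.m_assoc)
      qed
      have "?x \<otimes>\<^bsub>free_group S\<^esub> v [^]\<^bsub>free_group S\<^esub> n \<otimes>\<^bsub>free_group S\<^esub> ?y = \<one>\<^bsub>free_group S\<^esub>"
        using "1.prems"(3) pow[of n] by simp
      then have "inv\<^bsub>free_group S\<^esub> ?y = ?x \<otimes>\<^bsub>free_group S\<^esub> v [^]\<^bsub>free_group S\<^esub> n"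
        using carr vc by (intro F.inv_equality) auto
      moreover have "inv\<^bsub>free_group S\<^esub> ?y = ?x" using F.inv_inv[OF carr(1)] inv by simp
      ultimately have "v [^]\<^bsub>free_group S\<^esub> n = \<one>\<^bsub>free_group S\<^esub>" using carr vc by simp
      then have "v = []" using "1.IH" "1.prems" vc v by (auto simp: free_group_def)
      then show False using v "1.prems"(1) by (simp add: free_group_def)
    qed
  qed
qed

section \<open>Quaternions; commutation as parallelism of vector parts\<close>

datatype 'a quat = Quat 'a 'a 'a 'a

fun qmult :: "'a :: comm_ring_1 quat \<Rightarrow> 'a quat \<Rightarrow> 'a quat" where
  "qmult (Quat a b c d) (Quat a' b' c' d') =
     Quat (a * a' - b * b' - c * c' - d * d') (a * b' + b * a' + c * d' - d * c')
       (a * c' - b * d' + c * a' + d * b') (a * d' + b * c' - c * b' + d * a')"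

fun qconj :: "'a :: comm_ring_1 quat \<Rightarrow> 'a quat" where
  "qconj (Quat a b c d) = Quat a (- b) (- c) (- d)"

fun qnorm :: "'a :: comm_ring_1 quat \<Rightarrow> 'a" where
  "qnorm (Quat a b c d) = a\<^sup>2 + b\<^sup>2 + c\<^sup>2 + d\<^sup>2"

fun qscale :: "'a :: comm_ring_1 \<Rightarrow> 'a quat \<Rightarrow> 'a quat" where
  "qscale t (Quat a b c d) = Quat (t * a) (t * b) (t * c) (t * d)"

fun qscalar :: "'a :: zero quat \<Rightarrow> bool" where
  "qscalar (Quat a b c d) \<longleftrightarrow> b = 0 \<and> c = 0 \<and> d = 0"

definition unit_quats :: "real quat monoid" where
  "unit_quats = \<lparr>carrier = {q. qnorm q = 1}, mult = qmult, one = Quat 1 0 0 0\<rparr>"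

lemma qmult_assoc: "qmult (qmult p q) r = qmult p (qmult q r)"
  by (cases p; cases q; cases r) (simp add: algebra_simps)

lemma qmult_one [simp]: "qmult (Quat 1 0 0 0) q = q" "qmult q (Quat 1 0 0 0) = q"
  by (cases q; simp)+

lemma qnorm_mult: "qnorm (qmult p q) = qnorm p * qnorm q"
  by (cases p; cases q) (simp add: power2_eq_square algebra_simps)

lemma qmult_conj: "qmult q (qconj q) = Quat (qnorm q) 0 0 0" "qmult (qconj q) q = Quat (qnorm q) 0 0 0"
  by (cases q; simp add: power2_eq_square)+

lemma qconj_mult: "qconj (qmult p q) = qmult (qconj q) (qconj p)"
  by (cases p; cases q) (simp add: algebra_simps)

lemma qconj_conj [simp]: "qconj (qconj q) = q"
  by (cases q) simp

lemma qmult_scale: "qmult (qscale s p) (qscale t q) = qscale (s * t) (qmult p q)"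
  by (cases p; cases q) (simp add: algebra_simps)

lemma qnorm_conj [simp]: "qnorm (qconj q) = qnorm q"
  by (cases q) simp

lemma group_unit_quats: "group unit_quats"
proof (rule groupI)
  fix q assume "q \<in> carrier unit_quats"
  then show "\<exists>p\<in>carrier unit_quats. p \<otimes>\<^bsub>unit_quats\<^esub> q = \<one>\<^bsub>unit_quats\<^esub>"
    by (intro bexI[of _ "qconj q"]) (auto simp: unit_quats_def qmult_conj)
qed (auto simp: unit_quats_def qnorm_mult qmult_assoc)

lemma inv_unit_quats: "q \<in> carrier unit_quats \<Longrightarrow> inv\<^bsub>unit_quats\<^esub> q = qconj q"
  by (intro group.inv_equality[OF group_unit_quats]) (auto simp: unit_quats_def qmult_conj)

text \<open>The commutator pq - qp is twice the cross product of the vector parts, and the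
  right-hand side says that this product vanishes.\<close>

lemma quat_commute_iff:
  fixes a b c d :: real
  shows "qmult (Quat a b c d) (Quat a' b' c' d') = qmult (Quat a' b' c' d') (Quat a b c d) \<longleftrightarrow>
    b * c' = c * b' \<and> b * d' = d * b' \<and> c * d' = d * c'"
  (is "?L \<longleftrightarrow> ?R")
proof
  assume ?L
  then have "a * d' + b * c' - c * b' + d * a' = a' * d + b' * c - c' * b + d' * a"
    "a * c' - b * d' + c * a' + d * b' = a' * c - b' * d + c' * a + d' * b"
    "a * b' + b * a' + c * d' - d * c' = a' * b + b' * a + c' * d - d' * c"
    by (simp_all only: qmult.simps quat.inject)
  then show ?R by algebra
next
  assume ?R
  then show ?L unfolding qmult.simps quat.inject by algebra
qed

lemma parallelE:
  fixes b c d :: "'a :: field"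
  assumes "b \<noteq> 0 \<or> c \<noteq> 0 \<or> d \<noteq> 0"
    and "b * c' = c * b'" "b * d' = d * b'" "c * d' = d * c'"
  obtains t where "b' = t * b" "c' = t * c" "d' = t * d"
proof -
  consider "b \<noteq> 0" | "c \<noteq> 0" | "d \<noteq> 0" using assms(1) by blast
  then show thesis
  proof cases
    case 1 then show thesis using assms(2-4) by (intro that[of "b' / b"]) (auto simp: field_simps)
  next
    case 2 then show thesis using assms(2-4) by (intro that[of "c' / c"]) (auto simp: field_simps)
  next
    case 3 then show thesis using assms(2-4) by (intro that[of "d' / d"]) (auto simp: field_simps)
  qed
qed

text \<open>The centralizer of a non-scalar quaternion with vector part v is the plane spanned by 1
  and v, which is commutative.\<close>

lemma quat_commute_trans:
  fixes x y z :: "real quat"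
  assumes "\<not> qscalar x" "qmult x y = qmult y x" "qmult x z = qmult z x"
  shows "qmult y z = qmult z y"
proof -
  obtain a b c d where x: "x = Quat a b c d" by (cases x)
  obtain a1 b1 c1 d1 where y: "y = Quat a1 b1 c1 d1" by (cases y)
  obtain a2 b2 c2 d2 where z: "z = Quat a2 b2 c2 d2" by (cases z)
  have nz: "b \<noteq> 0 \<or> c \<noteq> 0 \<or> d \<noteq> 0" using assms(1) x by auto
  obtain t where t: "b1 = t * b" "c1 = t * c" "d1 = t * d"
    using parallelE[OF nz, of c1 b1 d1] assms(2) unfolding x y quat_commute_iff by metis
  obtain u where u: "b2 = u * b" "c2 = u * c" "d2 = u * d"
    using parallelE[OF nz, of c2 b2 d2] assms(3) unfolding x z quat_commute_iff by metis
  show ?thesis unfolding y z quat_commute_iff by (simp add: t u)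
qed

text \<open>Conjugation by \<open>g\<close> preserves the norm of the vector part, so a conjugate of \<open>x\<close> with
  vector part parallel to that of \<open>x\<close> is \<open>x\<close> or its quaternion conjugate.\<close>

lemma quat_conj_separated:
  fixes x y g :: "real quat"
  assumes g: "qnorm g = 1" and x: "\<not> qscalar x" and eq: "qmult g x = qmult y g"
    and comm: "qmult x y = qmult y x"
  shows "qmult (qmult g g) x = qmult x (qmult g g)"
proof -
  obtain a b c d where x': "x = Quat a b c d" by (cases x)
  obtain a1 b1 c1 d1 where y': "y = Quat a1 b1 c1 d1" by (cases y)
  obtain e f h k where g': "g = Quat e f h k" by (cases g)
  have y: "y = qmult (qmult g x) (qconj g)"
    using eq g by (simp add: qmult_assoc qmult_conj)
  have "a1 = (e\<^sup>2 + f\<^sup>2 + h\<^sup>2 + k\<^sup>2) * a"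
    using y unfolding x' y' g' by (simp add: power2_eq_square algebra_simps)
  then have re: "a1 = a" using g g' by simp
  have "qnorm (qmult g x) = qnorm (qmult y g)" by (simp only: eq)
  then have "qnorm y = qnorm x" using g by (simp add: qnorm_mult)
  then have n: "b1\<^sup>2 + c1\<^sup>2 + d1\<^sup>2 = b\<^sup>2 + c\<^sup>2 + d\<^sup>2" using x' y' re by simp
  have par: "b * c1 = c * b1" "b * d1 = d * b1" "c * d1 = d * c1"
    using comm unfolding x' y' quat_commute_iff by auto
  have nz: "b \<noteq> 0 \<or> c \<noteq> 0 \<or> d \<noteq> 0" using x x' by auto
  obtain t where t: "b1 = t * b" "c1 = t * c" "d1 = t * d"
    using parallelE[OF nz par] .
  have "b\<^sup>2 + c\<^sup>2 + d\<^sup>2 > 0"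
    using nz by (smt (verit) zero_less_power2 zero_le_power2)
  moreover have "t\<^sup>2 * (b\<^sup>2 + c\<^sup>2 + d\<^sup>2) = b\<^sup>2 + c\<^sup>2 + d\<^sup>2"
    using n t by (simp add: power_mult_distrib algebra_simps)
  ultimately have "t\<^sup>2 = 1" by simp
  then consider "t = 1" | "t = -1" by (auto simp: power2_eq_1_iff)
  then show ?thesis
  proof cases
    case 1
    then have "y = x" using t re x' y' by simp
    then show ?thesis using eq by (metis qmult_assoc)
  next
    case 2
    \<comment> \<open>Here \<open>g\<close> reverses the vector part of \<open>x\<close>, as i does
      to j, so \<open>g\<close> itself does not commute with \<open>x\<close> but its square
      does.\<close>
    then have yx: "y = qconj x" using t re x' y' by simp
    have "qmult g y = qmult g (qconj x)" using yx by simp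
    also have "\<dots> = qmult (qconj y) g"
      using g by (subst y) (simp add: qconj_mult qmult_assoc qmult_conj)
    finally have "qmult g y = qmult x g" using yx by simp
    then show ?thesis using eq by (metis qmult_assoc)
  qed
qed

text \<open>The letters 1 + 2i, 1 - 2i, 1 + 2j, 1 - 2j all have norm 5. Integer coordinates give
  access to divisibility by this prime; the division by \<open>sqrt 5\<close> that makes them units
  is postponed.\<close>

fun letter :: "nat \<times> bool \<Rightarrow> int quat" where
  "letter (s, b) = (let t = if b then 2 else -2 in if s = 0 then Quat 1 t 0 0 else Quat 1 0 t 0)"

definition word_quat :: "(nat \<times> bool) list \<Rightarrow> int quat" where
  "word_quat w = foldr (\<lambda>x q. qmult (letter x) q) w (Quat 1 0 0 0)"

lemma word_quat_simps [simp]: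
  "word_quat [] = Quat 1 0 0 0" "word_quat (x # w) = qmult (letter x) (word_quat w)"
  by (simp_all add: word_quat_def)

fun qdvd :: "int \<Rightarrow> int quat \<Rightarrow> bool" where
  "qdvd m (Quat a b c d) \<longleftrightarrow> m dvd a \<and> m dvd b \<and> m dvd c \<and> m dvd d"

lemma qnorm_word_quat: "qnorm (word_quat w) = 5 ^ length w"
proof (induction w)
  case (Cons x w)
  have "qnorm (letter x) = 5" by (cases x) (simp add: Let_def)
  then show ?case using Cons by (simp add: qnorm_mult)
qed simp

text \<open>For letters \<open>x\<close>, \<open>y\<close> one has \<open>y x y = t y - 5 x'\<close>, where \<open>x'\<close> is the conjugate of \<open>x\<close> and
  \<open>t\<close> is twice the real part of \<open>y x\<close>. Unless \<open>x\<close> and \<open>y\<close> are inverse letters, \<open>t\<close> is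
  prime to 5, so multiplying \<open>y u\<close> by \<open>x\<close> creates no divisibility by 5.\<close>

lemma qdvd_letter_mult:
  assumes xy: "fst x \<in> {0, 1}" "fst y \<in> {0, 1}" "y \<noteq> opp x"
    and dvd: "qdvd 5 (qmult (letter x) (qmult (letter y) u))"
  shows "qdvd 5 (qmult (letter y) u)"
proof -
  \<comment> \<open>Equal letters have a product with real part 1 - 4 = -3, letters on different
    axes one with real part 1. Inverse letters would give real part 5, hence t = 10.\<close>
  define t :: int where "t = (if x = y then -6 else 2)"
  have key: "qmult (letter y) (qmult (letter x) (qmult (letter y) u)) =
     (case (qmult (letter y) u, qmult (qconj (letter x)) u) of
       (Quat a b c d, Quat a' b' c' d') \<Rightarrow>
         Quat (t * a - 5 * a') (t * b - 5 * b') (t * c - 5 * c') (t * d - 5 * d'))"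
  proof -
    have x: "x \<in> {(0, True), (0, False), (1, True), (1, False)}"
      using xy(1) by (cases x; cases "snd x") auto
    have y: "y \<in> {(0, True), (0, False), (1, True), (1, False)}"
      using xy(2) by (cases y; cases "snd y") auto
    obtain a b c d where u: "u = Quat a b c d" by (cases u)
    show ?thesis using x y xy(3) unfolding u by (elim insertE emptyE) (simp_all add: t_def opp_def)
  qed
  have "qdvd 5 (qmult p q)" if "qdvd 5 q" for p q :: "int quat"
    using that by (cases p; cases q) auto
  then have d: "qdvd 5 (qmult (letter y) (qmult (letter x) (qmult (letter y) u)))"
    using dvd by blast
  have t5: "5 dvd a" if "5 dvd t * a - 5 * a'" for a a'
  proof -
    have "5 dvd t * a" using that by (metis dvd_diff_right_iff dvd_triv_left dvd_diff_left_iff)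
    moreover have "\<not> 5 dvd t" by (auto simp: t_def)
    ultimately show ?thesis by (simp add: prime_dvd_mult_iff)
  qed
  show ?thesis
    using d unfolding key by (auto split: quat.splits intro: t5)
qed

lemma word_quat_not_dvd:
  assumes "reduced w" "fst ` set w \<subseteq> {0, 1}"
  shows "\<not> qdvd 5 (word_quat w)"
  using assms
proof (induction w rule: reduced.induct)
  case (1 x y w)
  then show ?case using qdvd_letter_mult[of x y "word_quat w"] by auto
next
  case ("2_2" x)
  then show ?case by (cases x) (auto simp: Let_def)
qed simp

text \<open>A scalar value m would satisfy m^2 = 5^length by the norm, so 5 would divide m and with
  it all coordinates.\<close>

lemma word_quat_not_scalar:
  assumes "reduced w" "fst ` set w \<subseteq> {0, 1}" "w \<noteq> []"
  shows "\<not> qscalar (word_quat w)"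
proof
  assume "qscalar (word_quat w)"
  then obtain m where m: "word_quat w = Quat m 0 0 0" by (cases "word_quat w") auto
  then have "m\<^sup>2 = 5 ^ length w" using qnorm_word_quat[of w] by simp
  then have "5 dvd m\<^sup>2" using assms(3) by (metis dvd_power length_greater_0_conv)
  then have "5 dvd m" using prime_dvd_power[of 5 m 2] by simp
  then show False using word_quat_not_dvd[OF assms(1,2)] m by simp
qed

fun qreal :: "int quat \<Rightarrow> real quat" where
  "qreal (Quat a b c d) = Quat (of_int a) (of_int b) (of_int c) (of_int d)"

lemma qreal_mult: "qreal (qmult p q) = qmult (qreal p) (qreal q)"
  by (cases p; cases q) simp

lemma qscalar_scale: "t \<noteq> 0 \<Longrightarrow> qscalar (qscale t q) \<longleftrightarrow> qscalar (q :: real quat)"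
  by (cases q) simp

lemma qscalar_real: "qscalar (qreal q) \<longleftrightarrow> qscalar q"
  by (cases q) simp

text \<open>The image of a word is its integer quaternion divided by a power of
  \<open>sqrt 5\<close>, and rescaling does not affect being scalar.\<close>

lemma free_group_hom_unit_quats:
  obtains h where "h \<in> hom (free_group {0, 1 :: nat}) unit_quats"
    and "\<And>w. w \<in> carrier (free_group {0, 1}) \<Longrightarrow> w \<noteq> [] \<Longrightarrow> \<not> qscalar (h w)"
proof -
  let ?F = "free_group {0, 1 :: nat}"
  interpret F: group ?F by (rule group_free_group)
  define f where "f s = qscale (1 / sqrt 5) (qreal (letter (s, True)))" for s
  have "f \<in> {0, 1} \<rightarrow> carrier unit_quats"
    by (auto simp: f_def unit_quats_def power_divide)
  then obtain h where h: "h \<in> hom ?F unit_quats" "\<And>s. s \<in> {0, 1} \<Longrightarrow> h [(s, True)] = f s"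
    using free_group_extend[OF group_unit_quats, of f "{0, 1}"] by blast
  interpret h: group_hom ?F unit_quats h
    by (intro group_hom.intro group_hom_axioms.intro h(1) F.group_axioms group_unit_quats)
  have gen: "h [x] = qscale (1 / sqrt 5) (qreal (letter x))" if "fst x \<in> {0, 1}" for x
  proof (cases x)
    case (Pair s b)
    then have s: "s \<in> {0, 1}" using that by simp
    then have carr: "[(s, True)] \<in> carrier ?F" by (auto simp: free_group_def)
    show ?thesis
    proof (cases b)
      case True
      then show ?thesis using Pair s h(2) by (simp add: f_def)
    next
      case False
      have "inv\<^bsub>?F\<^esub> [(s, True)] = [(s, False)]"
        using s by (intro F.inv_equality) (auto simp: free_group_def opp_def)
      then have "h [(s, False)] = qconj (f s)"
        using h.hom_inv[OF carr] inv_unit_quats[of "h [(s, True)]"] h.hom_closed[OF carr] h(2)[OF s]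
        by simp
      then show ?thesis using Pair False by (simp add: f_def Let_def)
    qed
  qed
  have "\<exists>t. t \<noteq> 0 \<and> h w = qscale t (qreal (word_quat w))"
    if "reduced w" "fst ` set w \<subseteq> {0, 1}" for w
    using that
  proof (induction w)
    case Nil
    have "h [] = Quat 1 0 0 0" using h.hom_one by (simp add: unit_quats_def free_group_def)
    then show ?case by (intro exI[of _ 1]) simp
  next
    case (Cons x w)
    then obtain t where t: "t \<noteq> 0" "h w = qscale t (qreal (word_quat w))"
      using reduced_tl by (metis insert_subset list.simps(15) image_insert)
    have "h (x # w) = qmult (h [x]) (h w)"
      using Cons.prems reduced_tl[OF Cons.prems(1)] h.hom_mult[of "[x]" w]
      by (simp add: free_group_def unit_quats_def cancel_cons_reduced)
    also have "\<dots> = qscale (1 / sqrt 5 * t) (qreal (word_quat (x # w)))"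
      using t Cons.prems by (simp add: gen qmult_scale qreal_mult)
    finally show ?case using t by (intro exI[of _ "1 / sqrt 5 * t"]) simp
  qed
  then have "\<not> qscalar (h w)" if "w \<in> carrier ?F" "w \<noteq> []" for w
    using that word_quat_not_scalar[of w]
    by (auto simp: free_group_def) (metis qscalar_real qscalar_scale)
  then show ?thesis using that h(1) by blast
qed

text \<open>The unit quaternions themselves violate separation, since conjugation by i takes j to
  -j. In the free group the square of \<open>g\<close> is nontrivial and commutes with both
  \<open>g\<close> and \<open>x\<close>, so transitivity of commutation settles the matter for
  \<open>g\<close>.\<close>

lemma csa_free_group: "csa_group (free_group {0, 1 :: nat})"
proof -
  note One_nat_def [simp del]
  let ?F = "free_group {0, 1 :: nat}"
  obtain h where h: "h \<in> hom ?F unit_quats"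
    and ns: "\<And>w. w \<in> carrier ?F \<Longrightarrow> w \<noteq> \<one>\<^bsub>?F\<^esub> \<Longrightarrow> \<not> qscalar (h w)"
    using free_group_hom_unit_quats by (auto simp: free_group_def)
  interpret F: group ?F by (rule group_free_group)
  interpret h: group_hom ?F unit_quats h
    by (intro group_hom.intro group_hom_axioms.intro h(1) F.group_axioms group_unit_quats)
  have "inj_on h (carrier ?F)"
  proof (subst h.inj_on_one_iff, intro allI impI)
    fix w assume "w \<in> carrier ?F" "h w = \<one>\<^bsub>unit_quats\<^esub>"
    then show "w = \<one>\<^bsub>?F\<^esub>" using ns[of w] by (auto simp: unit_quats_def)
  qed
  then have eq: "x \<otimes>\<^bsub>?F\<^esub> y = z \<otimes>\<^bsub>?F\<^esub> w \<longleftrightarrow> qmult (h x) (h y) = qmult (h z) (h w)"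
    if "x \<in> carrier ?F" "y \<in> carrier ?F" "z \<in> carrier ?F" "w \<in> carrier ?F" for x y z w
    using that inj_on_eq_iff[of h "carrier ?F" "x \<otimes>\<^bsub>?F\<^esub> y" "z \<otimes>\<^bsub>?F\<^esub> w"]
    by (simp add: unit_quats_def)
  have ct: "y \<otimes>\<^bsub>?F\<^esub> z = z \<otimes>\<^bsub>?F\<^esub> y"
    if "x \<in> carrier ?F" "y \<in> carrier ?F" "z \<in> carrier ?F" "x \<noteq> \<one>\<^bsub>?F\<^esub>"
      "x \<otimes>\<^bsub>?F\<^esub> y = y \<otimes>\<^bsub>?F\<^esub> x" "x \<otimes>\<^bsub>?F\<^esub> z = z \<otimes>\<^bsub>?F\<^esub> x" for x y z
    using that ns[of x] quat_commute_trans[of "h x" "h y" "h z"] by (simp add: eq)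
  show ?thesis
  proof
    fix x y g
    assume x: "x \<in> carrier ?F" and y: "y \<in> carrier ?F" and g: "g \<in> carrier ?F"
      and c: "g \<otimes>\<^bsub>?F\<^esub> x = y \<otimes>\<^bsub>?F\<^esub> g" "x \<otimes>\<^bsub>?F\<^esub> y = y \<otimes>\<^bsub>?F\<^esub> x"
    show "g \<otimes>\<^bsub>?F\<^esub> x = x \<otimes>\<^bsub>?F\<^esub> g"
    proof (cases "x = \<one>\<^bsub>?F\<^esub> \<or> g = \<one>\<^bsub>?F\<^esub>")
      case False
      have "qnorm (h g) = 1" using h.hom_closed[OF g] by (simp add: unit_quats_def)
      then have "qmult (qmult (h g) (h g)) (h x) = qmult (h x) (qmult (h g) (h g))"
        using quat_conj_separated[of "h g" "h x" "h y"] c False x y g ns[of x] by (simp add: eq)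
      then have "(g \<otimes>\<^bsub>?F\<^esub> g) \<otimes>\<^bsub>?F\<^esub> x = x \<otimes>\<^bsub>?F\<^esub> (g \<otimes>\<^bsub>?F\<^esub> g)"
        using x g h.hom_mult[OF g g] by (simp add: eq) (simp add: unit_quats_def)
      moreover have "g \<otimes>\<^bsub>?F\<^esub> g \<noteq> \<one>\<^bsub>?F\<^esub>"
        using False free_group_torsion_free[of g "{0, 1}" 2] g by (auto simp: numeral_2_eq_2)
      ultimately show ?thesis using ct[of "g \<otimes>\<^bsub>?F\<^esub> g" g x] x g by (simp add: F.m_assoc)
    qed (use x g in auto)
  qed (use ct free_group_torsion_free in blast)+
qed

section \<open>Groups of bijections\<close>

lemma carrier_BijGroup: "carrier (BijGroup S) = Bij S"
  by (simp add: BijGroup_def)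

lemma Bij_closed: "f \<in> Bij S \<Longrightarrow> x \<in> S \<Longrightarrow> f x \<in> S"
  by (rule funcset_mem[OF Bij_imp_funcset])

lemma Bij_inj: "f \<in> Bij S \<Longrightarrow> x \<in> S \<Longrightarrow> y \<in> S \<Longrightarrow> f x = f y \<Longrightarrow> x = y"
  by (auto simp: Bij_def bij_betw_def dest: inj_onD)

lemma Bij_surj: "f \<in> Bij S \<Longrightarrow> x \<in> S \<Longrightarrow> \<exists>y\<in>S. x = f y"
  by (auto simp: Bij_def bij_betw_def)

lemma BijGroup_mult_apply:
  "f \<in> Bij S \<Longrightarrow> g \<in> Bij S \<Longrightarrow> x \<in> S \<Longrightarrow> (f \<otimes>\<^bsub>BijGroup S\<^esub> g) x = f (g x)"
  by (simp add: BijGroup_def compose_def)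

lemma BijGroup_one_apply: "x \<in> S \<Longrightarrow> \<one>\<^bsub>BijGroup S\<^esub> x = x"
  by (simp add: BijGroup_def)

lemma BijGroup_inv_apply:
  assumes "f \<in> Bij S" "x \<in> S"
  shows "(inv\<^bsub>BijGroup S\<^esub> f) (f x) = x" "f ((inv\<^bsub>BijGroup S\<^esub> f) x) = x"
proof -
  interpret group "BijGroup S" by (rule group_BijGroup)
  have f: "f \<in> carrier (BijGroup S)" "inv\<^bsub>BijGroup S\<^esub> f \<in> Bij S"
    using assms inv_closed[of f] by (simp_all add: carrier_BijGroup)
  show "(inv\<^bsub>BijGroup S\<^esub> f) (f x) = x"
    using l_inv[OF f(1)] BijGroup_mult_apply[OF f(2) assms] BijGroup_one_apply[OF assms(2)] by simp
  show "f ((inv\<^bsub>BijGroup S\<^esub> f) x) = x"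
    using r_inv[OF f(1)] BijGroup_mult_apply[OF assms(1) f(2) assms(2)]
      BijGroup_one_apply[OF assms(2)] by simp
qed

lemma Bij_eqI: "f \<in> Bij S \<Longrightarrow> g \<in> Bij S \<Longrightarrow> (\<And>x. x \<in> S \<Longrightarrow> f x = g x) \<Longrightarrow> f = g"
  by (auto simp: Bij_def intro: extensionalityI)

lemma Bij_pow: "f \<in> Bij S \<Longrightarrow> f [^]\<^bsub>BijGroup S\<^esub> (k :: nat) \<in> Bij S"
  using monoid.nat_pow_closed[OF group.is_monoid[OF group_BijGroup], of f S k]
  by (simp add: carrier_BijGroup)

lemma pow_fixed:
  "f \<in> Bij S \<Longrightarrow> x \<in> S \<Longrightarrow> f x = x \<Longrightarrow> (f [^]\<^bsub>BijGroup S\<^esub> (k :: nat)) x = x"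
  by (induction k) (simp_all add: BijGroup_one_apply BijGroup_mult_apply Bij_pow)

lemma disjoint_support_commute:
  assumes u: "u \<in> Bij S" and v: "v \<in> Bij S"
    and disj: "\<And>x. x \<in> S \<Longrightarrow> u x = x \<or> v x = x"
  shows "u \<otimes>\<^bsub>BijGroup S\<^esub> v = v \<otimes>\<^bsub>BijGroup S\<^esub> u"
proof (rule Bij_eqI)
  show "u \<otimes>\<^bsub>BijGroup S\<^esub> v \<in> Bij S" "v \<otimes>\<^bsub>BijGroup S\<^esub> u \<in> Bij S"
    using u v by (auto simp: BijGroup_def compose_Bij)
  fix x assume x: "x \<in> S"
  \<comment> \<open>If \<open>u\<close> moves x then by injectivity it also moves u x, so
    \<open>v\<close> fixes both points; likewise with the roles exchanged.\<close>
  have "u (v x) = v (u x)"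
    using disj[OF x] disj[OF Bij_closed[OF u x]] disj[OF Bij_closed[OF v x]]
      Bij_inj[OF u Bij_closed[OF u x] x] Bij_inj[OF v Bij_closed[OF v x] x] by metis
  then show "(u \<otimes>\<^bsub>BijGroup S\<^esub> v) x = (v \<otimes>\<^bsub>BijGroup S\<^esub> u) x"
    using u v x by (simp add: BijGroup_mult_apply)
qed

text \<open>The conjugate d = w c w^-1 is supported in w(U), outside the set \<open>U\<close> that
  supports \<open>c\<close>.\<close>

lemma conj_displaced_commute:
  assumes c: "c \<in> Bij S" and w: "w \<in> Bij S"
    and supp: "\<And>x. x \<in> S \<Longrightarrow> x \<notin> U \<Longrightarrow> c x = x" and disp: "\<And>x. x \<in> U \<Longrightarrow> w x \<notin> U"
  shows "\<exists>d\<in>Bij S. w \<otimes>\<^bsub>BijGroup S\<^esub> c = d \<otimes>\<^bsub>BijGroup S\<^esub> w \<and>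
    c \<otimes>\<^bsub>BijGroup S\<^esub> d = d \<otimes>\<^bsub>BijGroup S\<^esub> c"
proof -
  interpret group "BijGroup S" by (rule group_BijGroup)
  let ?d = "w \<otimes>\<^bsub>BijGroup S\<^esub> c \<otimes>\<^bsub>BijGroup S\<^esub> inv\<^bsub>BijGroup S\<^esub> w"
  have carr: "c \<in> carrier (BijGroup S)" "w \<in> carrier (BijGroup S)" using c w by (simp_all add: carrier_BijGroup)
  have d: "?d \<in> Bij S" using carr by (simp add: carrier_BijGroup[symmetric])
  have wc: "w \<otimes>\<^bsub>BijGroup S\<^esub> c = ?d \<otimes>\<^bsub>BijGroup S\<^esub> w" using carr by (simp add: m_assoc)
  have "c x = x \<or> ?d x = x" if x: "x \<in> S" for x
  proof (cases "x \<in> U")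
    case True
    obtain z where z: "z \<in> S" "x = w z" using Bij_surj[OF w x] by blast
    have "z \<notin> U" using disp[of z] True z(2) by auto
    then have "c z = z" using supp z(1) by blast
    then have "(w \<otimes>\<^bsub>BijGroup S\<^esub> c) z = x" using BijGroup_mult_apply[OF w c z(1)] z(2) by simp
    then have "?d x = x" using BijGroup_mult_apply[OF d w z(1)] wc z(2) by simp
    then show ?thesis ..
  qed (use supp x in blast)
  then have "c \<otimes>\<^bsub>BijGroup S\<^esub> ?d = ?d \<otimes>\<^bsub>BijGroup S\<^esub> c" by (rule disjoint_support_commute[OF c d])
  then show ?thesis using d wc by blast
qed

section \<open>Break sets\<close>

abbreviation unit_ival :: "real set" where "unit_ival \<equiv> {0..<1}"
abbreviation ival_bij :: "(real \<Rightarrow> real) monoid" where "ival_bij \<equiv> BijGroup unit_ival"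

interpretation IB: group ival_bij
  by (rule group_BijGroup)

text \<open>A break at \<open>x\<close> itself is harmless and a break at \<open>y\<close> is not, because the pieces are
  half-open on the right.\<close>

definition break_set :: "real set \<Rightarrow> (real \<Rightarrow> real) \<Rightarrow> bool" where
  "break_set D f \<longleftrightarrow> finite D \<and>
     (\<forall>x\<in>unit_ival. \<forall>y\<in>unit_ival. x \<le> y \<longrightarrow> {x<..y} \<inter> D = {} \<longrightarrow> f y - f x = y - x)"

lemma break_setD:
  "break_set D f \<Longrightarrow> x \<in> unit_ival \<Longrightarrow> y \<in> unit_ival \<Longrightarrow> x \<le> y \<Longrightarrow> {x<..y} \<inter> D = {} \<Longrightarrow>
    f y - f x = y - x"
  unfolding break_set_def by blast

lemma break_set_finite: "break_set D f \<Longrightarrow> finite D"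
  unfolding break_set_def by blast

lemma break_set_mono: "break_set D f \<Longrightarrow> D \<subseteq> E \<Longrightarrow> finite E \<Longrightarrow> break_set E f"
  unfolding break_set_def by blast

text \<open>The map is a translation from x to y, so a point of \<open>E\<close> between the images
  would have a preimage at the same offset from x.\<close>

lemma break_set_image_disjoint:
  assumes "break_set D f" and f: "f \<in> Bij unit_ival"
    and xy: "x \<in> unit_ival" "y \<in> unit_ival" "x \<le> y" "{x<..y} \<inter> D = {}"
    and E: "{x<..y} \<inter> {z \<in> unit_ival. f z \<in> E} = {}"
  shows "{f x<..f y} \<inter> E = {}"
proof (rule ccontr)
  assume "{f x<..f y} \<inter> E \<noteq> {}"
  then obtain e where e: "f x < e" "e \<le> f y" "e \<in> E" by auto
  define z where "z = x + (e - f x)"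
  have fy: "f y - f x = y - x" using break_setD[OF assms(1)] xy by blast
  have z: "x < z" "z \<le> y" "z \<in> unit_ival" using e fy xy by (auto simp: z_def)
  have "f z - f x = z - x"
    using xy z by (intro break_setD[OF assms(1)]) force+
  then have "f z = e" by (simp add: z_def)
  then show False using E e z by auto
qed

lemma finite_Bij_vimage: "f \<in> Bij S \<Longrightarrow> finite E \<Longrightarrow> finite {z \<in> S. f z \<in> E}"
  by (rule finite_inverse_image_gen[where A = E and D = S, simplified])
     (auto simp: Bij_def bij_betw_def)

lemma break_set_comp:
  assumes f: "f \<in> Bij unit_ival" "break_set D f" and g: "g \<in> Bij unit_ival" "break_set E g"
  shows "break_set (E \<union> {z \<in> unit_ival. g z \<in> D}) (f \<otimes>\<^bsub>ival_bij\<^esub> g)"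
  unfolding break_set_def
proof (intro conjI ballI impI)
  show "finite (E \<union> {z \<in> unit_ival. g z \<in> D})"
    using assms finite_Bij_vimage[of g unit_ival D] by (auto simp: break_set_def)
next
  fix x y assume xy: "x \<in> unit_ival" "y \<in> unit_ival" "x \<le> y"
    "{x<..y} \<inter> (E \<union> {z \<in> unit_ival. g z \<in> D}) = {}"
  have gxy: "g y - g x = y - x" using break_setD[OF g(2)] xy by blast
  have "{g x<..g y} \<inter> D = {}"
    using xy by (intro break_set_image_disjoint[OF g(2,1)]) auto
  then have "f (g y) - f (g x) = g y - g x"
    using gxy xy by (intro break_setD[OF f(2)] Bij_closed[OF g(1)]) auto
  then show "(f \<otimes>\<^bsub>ival_bij\<^esub> g) y - (f \<otimes>\<^bsub>ival_bij\<^esub> g) x = y - x"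
    using gxy xy by (simp add: BijGroup_mult_apply f g)
qed

lemma break_set_pow:
  assumes "f \<in> Bij unit_ival" "break_set D f"
  shows "\<exists>E. break_set E (f [^]\<^bsub>ival_bij\<^esub> (k :: nat))"
proof (induction k)
  case 0
  have "break_set {} \<one>\<^bsub>ival_bij\<^esub>" by (auto simp: break_set_def BijGroup_one_apply)
  then show ?case by auto
next
  case (Suc k)
  then obtain E where "break_set E (f [^]\<^bsub>ival_bij\<^esub> k)" by blast
  moreover have "f [^]\<^bsub>ival_bij\<^esub> k \<in> Bij unit_ival"
    using IB.nat_pow_closed[of f k] assms by (simp add: carrier_BijGroup)
  ultimately show ?case using break_set_comp[OF _ _ assms] by auto
qed

section \<open>Interval exchanges\<close>

lemma part_index_eq_of_no_beta:
  assumes l: "l \<in> Lambda n" and xy: "x \<in> unit_ival" "y \<in> unit_ival" "x \<le> y"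
    and no: "{x<..y} \<inter> beta l ` {..n} = {}"
  shows "part_index n l x = part_index n l y"
proof -
  obtain j where j: "j \<in> {1..n}" "x \<in> part l j" using ex_part[OF l xy(1)] by blast
  have "y < beta l j"
  proof (rule ccontr)
    assume "\<not> y < beta l j"
    then have "beta l j \<in> {x<..y}" using j by (simp add: part_def)
    then show False using no j(1) by auto
  qed
  then have "y \<in> part l j" using j xy by (simp add: part_def)
  then show ?thesis using j part_index_eq[OF l] by simp
qed

lemma iet_break_set: "l \<in> Lambda n \<Longrightarrow> break_set (beta l ` {..n}) (iet n p l)"
  unfolding break_set_def
proof (intro conjI ballI impI)
  fix x y assume l: "l \<in> Lambda n" and xy: "x \<in> unit_ival" "y \<in> unit_ival" "x \<le> y"
    "{x<..y} \<inter> beta l ` {..n} = {}"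
  then show "iet n p l y - iet n p l x = y - x"
    using part_index_eq_of_no_beta[OF l xy] by (simp add: iet_def)
qed simp

lemma iet_inverse:
  assumes l: "l \<in> Lambda n" and p: "p permutes {1..n}"
  shows "l \<circ> Hilbert_Choice.inv p \<in> Lambda n"
    and "x \<in> unit_ival \<Longrightarrow> iet n p l x \<in> unit_ival"
    and "x \<in> unit_ival \<Longrightarrow> iet n (Hilbert_Choice.inv p) (l \<circ> Hilbert_Choice.inv p) (iet n p l x) = x"
proof -
  let ?q = "Hilbert_Choice.inv p" and ?l = "l \<circ> Hilbert_Choice.inv p"
  have q: "?q permutes {1..n}" using p by (rule permutes_inv)
  have qp [simp]: "?q (p i) = i" "p (?q i) = i" for i using p permutes_inverses by metis+
  show l': "?l \<in> Lambda n"
    using l permutes_in_image[OF q] sum.permute[OF q, of l] by (auto simp: Lambda_def)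
  have sum: "(\<Sum>i\<in>{i\<in>{1..n}. P i}. l (?q i)) = (\<Sum>i\<in>{i\<in>{1..n}. P (p i)}. l i)" for P
    by (rule sum.reindex_bij_witness[of _ p ?q])
       (use permutes_in_image[OF p] permutes_in_image[OF q] in auto)
  fix x :: real assume x: "x \<in> unit_ival"
  then obtain j where j: "j \<in> {1..n}" "x \<in> part l j" using ex_part[OF l] by blast
  have pj: "p j \<in> {1..n}" using permutes_in_image[OF p] j by blast
  have beta: "beta l (j - 1) = (\<Sum>i\<in>{i\<in>{1..n}. i < j}. l i)"
    if "j \<in> {1..n}" for l :: "nat \<Rightarrow> real" and j
    unfolding beta_def using that by (intro sum.cong) auto
  have beta_step: "beta l j = beta l (j - 1) + l j"
    if "j \<in> {1..n}" for l :: "nat \<Rightarrow> real" and j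
    using that by (cases j) (auto simp: beta_def)
  have 1: "beta ?l (p j - 1) = (\<Sum>i\<in>{i\<in>{1..n}. p i < p j}. l i)"
    using beta[OF pj, of ?l] sum[of "\<lambda>i. i < p j"] by simp
  have om: "omega n p l j = beta ?l (p j - 1) - beta l (j - 1)"
    by (simp only: omega_def 1 beta[OF j(1)])
  \<comment> \<open>The exchange carries piece \<open>j\<close> onto piece \<open>p j\<close> of the
    partition with permuted lengths; \<open>omega\<close> is the difference of the left
    endpoints.\<close>
  have "x + omega n p l j \<in> part ?l (p j)"
    using j(2) beta_step[OF j(1), of l] beta_step[OF pj, of ?l] om by (simp add: part_def)
  then have y: "iet n p l x \<in> part ?l (p j)" using iet_apply[OF l j] by simp
  then show "iet n p l x \<in> unit_ival" using part_subset[OF l' pj] by blast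
  have "omega n ?q ?l (p j) = (\<Sum>i\<in>{i\<in>{1..n}. i < j}. l i) - (\<Sum>i\<in>{i\<in>{1..n}. p i < p j}. l i)"
    using sum[of "\<lambda>i. ?q i < j"] sum[of "\<lambda>i. i < p j"] by (simp add: omega_def)
  then have "omega n ?q ?l (p j) = - omega n p l j"
    by (simp add: omega_def)
  then show "iet n ?q ?l (iet n p l x) = x"
    using iet_apply[OF l' pj y] iet_apply[OF l j] by simp
qed

lemma IET_Bij_inverse:
  assumes "f \<in> IETs"
  shows "f \<in> Bij unit_ival" and "\<exists>g\<in>IETs. \<forall>x\<in>unit_ival. g (f x) = x"
proof -
  obtain n p l where f: "f = iet n p l" "n \<ge> 1" and p: "p permutes {1..n}" and l: "l \<in> Lambda n"
    using assms by (auto simp: IETs_def)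
  let ?g = "iet n (Hilbert_Choice.inv p) (l \<circ> Hilbert_Choice.inv p)"
  note q = permutes_inv[OF p]
  note inv = iet_inverse[OF l p]
  \<comment> \<open>Inverting the data twice restores them, so \<open>iet_inverse\<close> also shows
    that \<open>?g\<close> is a right inverse.\<close>
  have "l \<circ> Hilbert_Choice.inv p \<circ> Hilbert_Choice.inv (Hilbert_Choice.inv p) = l"
    using p by (simp add: permutes_inv_inv permutes_inv_o comp_assoc)
  then have "iet n p l (?g x) = x" "?g x \<in> unit_ival" if "x \<in> unit_ival" for x
    using iet_inverse[OF inv(1) q] that by (simp_all add: permutes_inv_inv[OF p])
  then have "bij_betw (iet n p l) unit_ival unit_ival"
    using inv by (intro bij_betw_byWitness[where f' = ?g]) auto
  then show "f \<in> Bij unit_ival" by (simp add: Bij_def f iet_def)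
  show "\<exists>g\<in>IETs. \<forall>x\<in>unit_ival. g (f x) = x"
    using inv q f by (intro bexI[of _ ?g]) (auto simp: IETs_def)
qed

lemma IET_inv_closed:
  assumes f: "f \<in> IETs"
  shows "inv\<^bsub>ival_bij\<^esub> f \<in> IETs"
proof -
  obtain g where g: "g \<in> IETs" "\<forall>x\<in>unit_ival. g (f x) = x" using IET_Bij_inverse[OF f] by blast
  note B = IET_Bij_inverse(1)[OF f] IET_Bij_inverse(1)[OF g(1)]
  have "g \<otimes>\<^bsub>ival_bij\<^esub> f = \<one>\<^bsub>ival_bij\<^esub>"
  proof (rule Bij_eqI[where S = unit_ival])
    show "g \<otimes>\<^bsub>ival_bij\<^esub> f \<in> Bij unit_ival" "\<one>\<^bsub>ival_bij\<^esub> \<in> Bij unit_ival"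
      using B IB.m_closed[of g f] IB.one_closed by (simp_all add: carrier_BijGroup)
  qed (use B g in \<open>simp add: BijGroup_mult_apply BijGroup_one_apply\<close>)
  then have "inv\<^bsub>ival_bij\<^esub> f = g"
    using B by (intro IB.inv_equality) (simp_all add: carrier_BijGroup)
  then show ?thesis using g by simp
qed

lemma IETs_subset: "IETs \<subseteq> carrier ival_bij"
  using IET_Bij_inverse(1) by (auto simp: carrier_BijGroup)

lemma IET_break_set: "f \<in> IETs \<Longrightarrow> \<exists>D. break_set D f"
  using iet_break_set by (auto simp: IETs_def)

lemma IET_group_simps:
  "carrier IET_group = IETs" "f \<otimes>\<^bsub>IET_group\<^esub> g = f \<otimes>\<^bsub>ival_bij\<^esub> g" "\<one>\<^bsub>IET_group\<^esub> = \<one>\<^bsub>ival_bij\<^esub>"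
  by (simp_all add: IET_group_def)

lemma inv_IET_group:
  assumes f: "f \<in> IETs"
  shows "inv\<^bsub>IET_group\<^esub> f = inv\<^bsub>ival_bij\<^esub> f"
  unfolding m_inv_def[of IET_group] IET_group_simps
proof (rule the_equality)
  have fc: "f \<in> carrier ival_bij" using f IETs_subset by blast
  show "inv\<^bsub>ival_bij\<^esub> f \<in> IETs \<and> f \<otimes>\<^bsub>ival_bij\<^esub> inv\<^bsub>ival_bij\<^esub> f = \<one>\<^bsub>ival_bij\<^esub> \<and>
      inv\<^bsub>ival_bij\<^esub> f \<otimes>\<^bsub>ival_bij\<^esub> f = \<one>\<^bsub>ival_bij\<^esub>"
    using IET_inv_closed[OF f] fc by simp
  fix g assume "g \<in> IETs \<and> f \<otimes>\<^bsub>ival_bij\<^esub> g = \<one>\<^bsub>ival_bij\<^esub> \<and> g \<otimes>\<^bsub>ival_bij\<^esub> f = \<one>\<^bsub>ival_bij\<^esub>"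
  then show "g = inv\<^bsub>ival_bij\<^esub> f"
    using fc IETs_subset IB.inv_equality[of g f] by auto
qed

text \<open>Multiplication and unit are shared, and \<open>generate\<close> inverts generators only,
  so agreement of the two inverses on \<open>IETs\<close> is enough.\<close>

lemma generate_IET_group:
  assumes "H \<subseteq> IETs"
  shows "generate IET_group H = generate ival_bij H"
proof (intro equalityI subsetI)
  fix x assume "x \<in> generate IET_group H"
  then show "x \<in> generate ival_bij H"
  proof induction
    case (inv h)
    then show ?case using generate.inv[of h H ival_bij] assms inv_IET_group[of h] by auto
  next
    case (eng f g)
    then show ?case using generate.eng[of f ival_bij H g] by (simp add: IET_group_simps)
  qed (use generate.one[of ival_bij H] generate.incl[of _ H ival_bij] in
      \<open>simp_all add: IET_group_simps\<close>)
next
  fix x assume "x \<in> generate ival_bij H"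
  then show "x \<in> generate IET_group H"
  proof induction
    case (inv h)
    then show ?case using generate.inv[of h H IET_group] assms inv_IET_group[of h] by auto
  next
    case (eng f g)
    then show ?case using generate.eng[of f IET_group H g] by (simp add: IET_group_simps)
  qed (use generate.one[of IET_group H] generate.incl[of _ H IET_group] in
      \<open>simp_all add: IET_group_simps\<close>)
qed

section \<open>Disjoint rotations\<close>

lemma beta_step: "j \<ge> 1 \<Longrightarrow> beta l j = beta l (j - 1) + l j"
  by (cases j) (auto simp: beta_def)

text \<open>A flow with real time: each piece, closed up to a circle of length \<open>l j\<close>,
  turns by \<open>t * a j\<close> full turns. Time 1 is the disjoint rotation, time k its k-th
  power, and time -t inverts time t.\<close>

definition rot :: "nat \<Rightarrow> (nat \<Rightarrow> real) \<Rightarrow> (nat \<Rightarrow> real) \<Rightarrow> real \<Rightarrow> real \<Rightarrow> real" where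
  "rot n a l t = (\<lambda>x\<in>unit_ival. let j = part_index n l x in
     beta l (j - 1) + l j * frac ((x - beta l (j - 1)) / l j + t * a j))"

context
  fixes n :: nat and l a :: "nat \<Rightarrow> real"
  assumes l: "l \<in> Lambda n"
begin

lemma l_pos: "j \<in> {1..n} \<Longrightarrow> l j > 0"
  using l by (auto simp: Lambda_def)

lemma rot_apply:
  assumes "j \<in> {1..n}" "x \<in> part l j"
  shows "rot n a l t x = beta l (j - 1) + l j * frac ((x - beta l (j - 1)) / l j + t * a j)"
  using assms part_subset[OF l assms(1)] part_index_eq[OF l assms] by (auto simp: rot_def Let_def)

lemma rot_part:
  assumes j: "j \<in> {1..n}" and x: "x \<in> part l j"
  shows "rot n a l t x \<in> part l j"
  using rot_apply[OF assms] l_pos[OF j] beta_step[of j l] j frac_lt_1 by (auto simp: part_def)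

lemma rot_closed: "x \<in> unit_ival \<Longrightarrow> rot n a l t x \<in> unit_ival"
  using ex_part[OF l, of x] rot_part part_subset[OF l] by blast

text \<open>The integer \<open>m\<close> counts completed turns; while the shifted point stays in
  the piece, \<open>frac\<close> just subtracts \<open>m\<close>. The values 0 and 1 give the two
  branches of a disjoint rotation, approximating integers the small shifts.\<close>

lemma rot_shift:
  assumes j: "j \<in> {1..n}" and x: "x \<in> part l j" "x + d \<in> part l j"
    and d: "d = l j * (t * a j - of_int m)"
  shows "rot n a l t x = x + d"
proof -
  have lj: "l j > 0" using l_pos[OF j] .
  define u where "u = (x + d - beta l (j - 1)) / l j"
  have u: "0 \<le> u" "u < 1" using x(2) lj beta_step[of j l] j by (auto simp: u_def part_def)
  have "(x - beta l (j - 1)) / l j + t * a j = u + of_int m"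
    using lj by (simp add: u_def d field_simps)
  then have "frac ((x - beta l (j - 1)) / l j + t * a j) = u"
    using u by (simp add: frac_eq)
  then show ?thesis using rot_apply[OF j x(1)] lj by (simp add: u_def)
qed

lemma rot_0: "x \<in> unit_ival \<Longrightarrow> rot n a l 0 x = x"
  using ex_part[OF l, of x] rot_shift[of _ x 0 0 0] by auto

lemma rot_add:
  assumes "x \<in> unit_ival"
  shows "rot n a l t (rot n a l u x) = rot n a l (t + u) x"
proof -
  obtain j where j: "j \<in> {1..n}" "x \<in> part l j" using ex_part[OF l assms] by blast
  have lj: "l j > 0" using l_pos[OF j(1)] .
  have frac: "frac (frac v + w) = frac (v + w)" for v w :: real
    by (simp add: frac_def floor_diff_of_int algebra_simps)
  let ?b = "beta l (j - 1)"
  have "rot n a l t (rot n a l u x) = ?b + l j * frac ((rot n a l u x - ?b) / l j + t * a j)"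
    by (rule rot_apply[OF j(1) rot_part[OF j]])
  also have "(rot n a l u x - ?b) / l j = frac ((x - ?b) / l j + u * a j)"
    using rot_apply[OF j, of u] lj by simp
  also have "frac (frac ((x - ?b) / l j + u * a j) + t * a j) = frac ((x - ?b) / l j + (t + u) * a j)"
    by (simp only: frac) (simp add: algebra_simps)
  finally show ?thesis using rot_apply[OF j, of "t + u"] by simp
qed

text \<open>The criterion is independent of x: a rotation fixes all points of its circle or
  none.\<close>

lemma rot_eq_self_iff:
  assumes j: "j \<in> {1..n}" and x: "x \<in> part l j"
  shows "rot n a l t x = x \<longleftrightarrow> t * a j \<in> \<int>"
proof
  have lj: "l j > 0" using l_pos[OF j] .
  let ?u = "(x - beta l (j - 1)) / l j"
  assume "rot n a l t x = x"
  then have "frac (?u + t * a j) = ?u" using rot_apply[OF j x] lj by (simp add: field_simps)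
  then have "t * a j = of_int \<lfloor>?u + t * a j\<rfloor>" by (simp add: frac_def)
  then show "t * a j \<in> \<int>" by (metis Ints_of_int)
next
  assume "t * a j \<in> \<int>"
  then obtain m :: int where "t * a j = of_int m" by (elim Ints_cases)
  then show "rot n a l t x = x" using rot_shift[OF j x, of 0 t m] x by simp
qed

lemma rot_Bij: "rot n a l t \<in> Bij unit_ival"
proof -
  have "bij_betw (rot n a l t) unit_ival unit_ival"
    by (intro bij_betw_byWitness[where f' = "rot n a l (- t)"])
       (use rot_closed in \<open>auto simp: rot_add rot_0\<close>)
  then show ?thesis by (simp add: Bij_def rot_def)
qed

lemma disjoint_rotation_eq_rot:
  assumes a: "\<forall>j\<in>{1..n}. a j \<in> {0..<1}"
  shows "disjoint_rotation n a l = rot n a l 1"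
proof (rule extensionalityI)
  fix x :: real assume "x \<in> unit_ival"
  then obtain j where j: "j \<in> {1..n}" "x \<in> part l j" using ex_part[OF l] by blast
  have lj: "l j > 0" "0 \<le> a j" "a j < 1" using l_pos[OF j(1)] a j(1) by auto
  have b: "beta l j = beta l (j - 1) + l j" using beta_step j(1) by simp
  have la: "0 \<le> l j * a j" "l j * a j < l j" using lj by auto
  show "disjoint_rotation n a l x = rot n a l 1 x"
  proof (cases "x < beta l j - l j * a j")
    case True
    then have "x + l j * a j \<in> part l j" using j(2) la by (simp add: part_def)
    then have "rot n a l 1 x = x + l j * a j" by (rule rot_shift[OF j, where m = 0]) simp
    moreover have "x \<in> {beta l (j - 1)..<beta l j - l j * a j}" using True j(2) by (simp add: part_def)
    ultimately show ?thesis unfolding disjoint_rotation_apply[OF l j] by (simp only: if_True)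
  next
    case False
    then have "x + (l j * a j - l j) \<in> part l j" using j(2) la b by (simp add: part_def)
    then have "rot n a l 1 x = x + (l j * a j - l j)"
      by (rule rot_shift[OF j, where m = 1]) (simp add: algebra_simps)
    moreover have "x \<notin> {beta l (j - 1)..<beta l j - l j * a j}" using False by simp
    ultimately show ?thesis unfolding disjoint_rotation_apply[OF l j] by (simp only: if_False)
  qed
qed (auto simp: disjoint_rotation_def rot_def)

lemma disjoint_rotation_break_set:
  "break_set (beta l ` {..n} \<union> (\<lambda>j. beta l j - l j * a j) ` {..n}) (disjoint_rotation n a l)"
  unfolding break_set_def
proof (intro conjI ballI impI)
  fix x y assume xy: "x \<in> unit_ival" "y \<in> unit_ival" "x \<le> y"
    and no: "{x<..y} \<inter> (beta l ` {..n} \<union> (\<lambda>j. beta l j - l j * a j) ` {..n}) = {}"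
  obtain j where j: "j \<in> {1..n}" "x \<in> part l j" using ex_part[OF l xy(1)] by blast
  have "part_index n l x = part_index n l y"
    using no by (intro part_index_eq_of_no_beta[OF l xy]) auto
  then have ij: "part_index n l x = j" "part_index n l y = j" using part_index_eq[OF l j] by auto
  have "beta l j - l j * a j \<notin> {x<..y}" using no j(1) by auto
  then have "x < beta l j - l j * a j \<longleftrightarrow> y < beta l j - l j * a j" using xy(3) by auto
  then show "disjoint_rotation n a l y - disjoint_rotation n a l x = y - x"
    using xy ij by (auto simp: disjoint_rotation_def)
qed simp

lemma rot_pow:
  "x \<in> unit_ival \<Longrightarrow> (rot n a l 1 [^]\<^bsub>ival_bij\<^esub> (k :: nat)) x = rot n a l k x"
proof (induction k arbitrary: x)
  case 0
  then show ?case by (simp add: BijGroup_one_apply rot_0)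
next
  case (Suc k)
  have "rot n a l 1 [^]\<^bsub>ival_bij\<^esub> k \<in> Bij unit_ival"
    using IB.nat_pow_closed rot_Bij by (simp add: carrier_BijGroup[symmetric])
  then have "(rot n a l 1 [^]\<^bsub>ival_bij\<^esub> Suc k) x = (rot n a l 1 [^]\<^bsub>ival_bij\<^esub> k) (rot n a l 1 x)"
    using BijGroup_mult_apply[OF _ rot_Bij Suc.prems] by simp
  also have "\<dots> = rot n a l (real k + 1) x"
    using Suc.IH[OF rot_closed[OF Suc.prems]] rot_add[OF Suc.prems] by simp
  finally show ?case by (simp add: add.commute)
qed

end

text \<open>The second alternative says that \<open>a j\<close> is irrational. Multiplying
  \<open>N\<close> by a denominator of the next rational angle keeps the earlier multiples
  integral.\<close>

lemma ex_common_period: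
  fixes a :: "nat \<Rightarrow> real"
  shows "\<exists>N>0. \<forall>j\<in>{1..n}. of_nat N * a j \<in> \<int> \<or> (\<forall>k>0. of_nat k * a j \<notin> \<int>)"
proof (induction n)
  case 0
  then show ?case by (intro exI[of _ 1]) simp
next
  case (Suc n)
  then obtain N where N: "N > 0" "\<forall>j\<in>{1..n}. of_nat N * a j \<in> \<int> \<or> (\<forall>k>0. of_nat k * a j \<notin> \<int>)"
    by blast
  have mult: "of_nat (M * k) * a j \<in> \<int>" if "of_nat k * a j \<in> \<int>" for M k j
    using Ints_mult[OF Ints_of_nat that, of M] by (simp add: mult.assoc)
  show ?case
  proof (cases "\<exists>k>0. of_nat k * a (Suc n) \<in> \<int>")
    case True
    then obtain k where k: "k > 0" "of_nat k * a (Suc n) \<in> \<int>" by blast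
    show ?thesis
    proof (intro exI[of _ "N * k"] conjI ballI)
      fix j assume "j \<in> {1..Suc n}"
      then consider "j = Suc n" | "of_nat N * a j \<in> \<int>" | "\<forall>k>0. of_nat k * a j \<notin> \<int>"
        using N(2) by (metis atLeastAtMost_iff le_SucE)
      then show "of_nat (N * k) * a j \<in> \<int> \<or> (\<forall>k>0. of_nat k * a j \<notin> \<int>)"
        using mult[OF k(2), of N] mult[of N j k] by cases (auto simp: mult.commute[of N k] simp del: of_nat_mult)
    qed (use N k in simp)
  next
    case False
    show ?thesis
    proof (intro exI[of _ N] conjI ballI)
      fix j assume "j \<in> {1..Suc n}"
      then have "j = Suc n \<or> j \<in> {1..n}" by auto
      then show "of_nat N * a j \<in> \<int> \<or> (\<forall>k>0. of_nat k * a j \<notin> \<int>)"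
        using N(2) False by blast
    qed (use N in simp)
  qed
qed

lemma ex_simultaneous_approx:
  fixes \<theta> :: "nat \<Rightarrow> real"
  assumes "\<epsilon> > 0"
  shows "\<exists>k>0. \<exists>m :: nat \<Rightarrow> int. \<forall>j\<le>n. \<bar>of_nat k * \<theta> j - of_int (m j)\<bar> < \<epsilon>"
proof -
  obtain M :: nat where M: "M > 0" "1 / of_nat M < \<epsilon>"
    using assms by (metis nat_approx_posE zero_less_Suc)
  obtain q p where q: "0 < q" "\<And>i. i < Suc n \<Longrightarrow> \<bar>of_int q * \<theta> i - of_int (p i)\<bar> < 1 / M"
    using Dirichlet_approx_simult[OF M(1), of "Suc n" \<theta>] by blast
  show ?thesis
  proof (intro exI[of _ "nat q"] conjI exI[of _ p] allI impI)
    fix j assume "j \<le> n"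
    then have "\<bar>of_int q * \<theta> j - of_int (p j)\<bar> < \<epsilon>" using q(2)[of j] M(2) by simp
    then show "\<bar>of_nat (nat q) * \<theta> j - of_int (p j)\<bar> < \<epsilon>" using q(1) by simp
  qed (use q in simp)
qed

section \<open>Conjugates of powers of disjoint rotations\<close>

text \<open>The displacement \<delta> is a separate function because it describes \<open>f\<close>
  only away from \<open>D\<close>: a point within \<epsilon> of a break may be carried across it and
  then end up far away.\<close>

definition small_shift :: "real set \<Rightarrow> real \<Rightarrow> (real \<Rightarrow> real) \<Rightarrow> (real \<Rightarrow> real) \<Rightarrow> bool" where
  "small_shift D \<epsilon> \<delta> f \<longleftrightarrow> (\<forall>x\<in>unit_ival. \<bar>\<delta> x\<bar> < \<epsilon>) \<and>
     (\<forall>x\<in>unit_ival. \<forall>y\<in>unit_ival. x \<le> y \<longrightarrow> {x<..y} \<inter> D = {} \<longrightarrow> \<delta> x = \<delta> y) \<and>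
     (\<forall>x\<in>unit_ival. (\<forall>d\<in>D. \<epsilon> \<le> \<bar>x - d\<bar>) \<longrightarrow> f x = x + \<delta> x)"

text \<open>Satisfied by \<open>A = h s\<^sup>N h\<^sup>-\<^sup>1\<close> when \<open>s\<close> is a disjoint rotation and \<open>N\<close> is a common
  period of its rational circles.\<close>

definition tame :: "real set \<Rightarrow> (real \<Rightarrow> real) \<Rightarrow> bool" where
  "tame D A \<longleftrightarrow> A \<in> Bij unit_ival \<and> break_set D A \<and>
     (\<forall>x\<in>unit_ival. A x \<noteq> x \<longrightarrow> (\<forall>k>0. (A [^]\<^bsub>ival_bij\<^esub> (k :: nat)) x \<noteq> x)) \<and>
     (\<forall>x\<in>unit_ival. \<forall>y\<in>unit_ival. x \<le> y \<longrightarrow> {x<..y} \<inter> D = {} \<longrightarrow> (A x = x \<longleftrightarrow> A y = y)) \<and>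
     (\<forall>\<epsilon>>0. \<exists>k>0. \<exists>\<delta>. small_shift D \<epsilon> \<delta> (A [^]\<^bsub>ival_bij\<^esub> (k :: nat)))"

lemma small_shift_mono: "small_shift D \<epsilon> \<delta> f \<Longrightarrow> D \<subseteq> E \<Longrightarrow> small_shift E \<epsilon> \<delta> f"
  unfolding small_shift_def by blast

lemma tameD:
  assumes "tame D A"
  shows "A \<in> Bij unit_ival" "break_set D A"
    and "x \<in> unit_ival \<Longrightarrow> A x \<noteq> x \<Longrightarrow> k > 0 \<Longrightarrow> (A [^]\<^bsub>ival_bij\<^esub> (k :: nat)) x \<noteq> x"
    and "x \<in> unit_ival \<Longrightarrow> y \<in> unit_ival \<Longrightarrow> x \<le> y \<Longrightarrow> {x<..y} \<inter> D = {} \<Longrightarrow> A x = x \<longleftrightarrow> A y = y"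
    and "\<epsilon> > 0 \<Longrightarrow> \<exists>k>0. \<exists>\<delta>. small_shift D \<epsilon> \<delta> (A [^]\<^bsub>ival_bij\<^esub> (k :: nat))"
  using assms unfolding tame_def by blast+

lemma tame_mono:
  assumes "tame D A" "D \<subseteq> E" "finite E"
  shows "tame E A"
proof -
  note D = tameD[OF assms(1)]
  have no: "{x<..y} \<inter> D = {}" if "{x<..y} \<inter> E = {}" for x y using that assms(2) by blast
  show ?thesis
    unfolding tame_def
  proof (intro conjI ballI allI impI)
    show "A \<in> Bij unit_ival" by (rule D(1))
    show "break_set E A" by (rule break_set_mono[OF D(2) assms(2,3)])
    show "(A [^]\<^bsub>ival_bij\<^esub> k) x \<noteq> x" if "x \<in> unit_ival" "A x \<noteq> x" "k > 0" for x and k :: nat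
      using that by (rule D(3))
    show "A x = x \<longleftrightarrow> A y = y"
      if "x \<in> unit_ival" "y \<in> unit_ival" "x \<le> y" "{x<..y} \<inter> E = {}" for x y
      using D(4)[OF that(1-3) no[OF that(4)]] .
    show "\<exists>k>0. \<exists>\<delta>. small_shift E \<epsilon> \<delta> (A [^]\<^bsub>ival_bij\<^esub> (k :: nat))" if "\<epsilon> > 0" for \<epsilon>
      using D(5)[OF that] small_shift_mono[OF _ assms(2)] by blast
  qed
qed

lemma far_interval_disjoint:
  fixes x y z e :: real
  assumes "\<forall>d\<in>D. e \<le> \<bar>x - d\<bar>" "\<bar>y - x\<bar> < e" "\<bar>z - x\<bar> < e"
  shows "{y<..z} \<inter> D = {}"
proof -
  have "d \<notin> {y<..z}" if "d \<in> D" for d using assms(1)[rule_format, OF that] assms(2,3) by auto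
  then show ?thesis by blast
qed

lemma tame_conj_disjoint_rotation:
  assumes l: "l \<in> Lambda n" and a: "\<forall>j\<in>{1..n}. a j \<in> {0..<1}"
    and N: "N > 0" "\<forall>j\<in>{1..n}. of_nat N * a j \<in> \<int> \<or> (\<forall>k>0. of_nat k * a j \<notin> \<int>)"
    and h: "h \<in> Bij unit_ival" "break_set D h" "break_set E (inv\<^bsub>ival_bij\<^esub> h)"
  defines "A \<equiv> (h \<otimes>\<^bsub>ival_bij\<^esub> disjoint_rotation n a l \<otimes>\<^bsub>ival_bij\<^esub> inv\<^bsub>ival_bij\<^esub> h) [^]\<^bsub>ival_bij\<^esub> N"
  shows "\<exists>D. tame D A"
proof -
  let ?s = "disjoint_rotation n a l" and ?f = "inv\<^bsub>ival_bij\<^esub> h"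
  define j where "j x = part_index n l (?f x)" for x
  \<comment> \<open>Between points of \<open>D1\<close> the inverse of \<open>h\<close> is a
    translation into a single circle. With 0 and 1 included, small shifts of points far from
    \<open>D1\<close> stay in the interval.\<close>
  define D1 where "D1 = {0, 1} \<union> E \<union> {z \<in> unit_ival. ?f z \<in> beta l ` {..n}}"
  note s = disjoint_rotation_eq_rot[OF l a]
  have sB: "?s \<in> Bij unit_ival" using rot_Bij[OF l, of a 1] s by simp
  have fB: "?f \<in> Bij unit_ival" using h(1) IB.inv_closed[of h] by (simp add: carrier_BijGroup)
  have C: "h \<in> carrier ival_bij" "?s \<in> carrier ival_bij" "?f \<in> carrier ival_bij"
    using h(1) sB fB by (simp_all add: carrier_BijGroup)
  then have AB: "A \<in> Bij unit_ival" unfolding A_def carrier_BijGroup[symmetric] by simp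
  have hf: "h (?f x) = x" "?f (h x) = x" if "x \<in> unit_ival" for x
    using BijGroup_inv_apply[OF h(1) that] by auto
  have pow: "(A [^]\<^bsub>ival_bij\<^esub> k) x = h (rot n a l (real (N * k)) (?f x))" if x: "x \<in> unit_ival" for k :: nat and x
  proof -
    have Ak: "A [^]\<^bsub>ival_bij\<^esub> k = h \<otimes>\<^bsub>ival_bij\<^esub> ?s [^]\<^bsub>ival_bij\<^esub> (N * k) \<otimes>\<^bsub>ival_bij\<^esub> ?f"
      using C by (simp add: A_def IB.nat_pow_pow IB.conj_pow)
    have P: "?s [^]\<^bsub>ival_bij\<^esub> (N * k) \<in> Bij unit_ival"
      using IB.nat_pow_closed[OF C(2)] by (simp add: carrier_BijGroup)
    have Q: "h \<otimes>\<^bsub>ival_bij\<^esub> ?s [^]\<^bsub>ival_bij\<^esub> (N * k) \<in> Bij unit_ival"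
      using IB.m_closed[OF C(1) IB.nat_pow_closed[OF C(2)]] by (simp add: carrier_BijGroup)
    show ?thesis
      unfolding Ak BijGroup_mult_apply[OF Q fB x] BijGroup_mult_apply[OF h(1) P Bij_closed[OF fB x]]
      unfolding s rot_pow[OF l Bij_closed[OF fB x]] ..
  qed
  have part: "j x \<in> {1..n}" "?f x \<in> part l (j x)" if x: "x \<in> unit_ival" for x
  proof -
    obtain i where "i \<in> {1..n}" "?f x \<in> part l i" using ex_part[OF l Bij_closed[OF fB x]] by blast
    then show "j x \<in> {1..n}" "?f x \<in> part l (j x)" using part_index_eq[OF l] by (auto simp: j_def)
  qed
  have finD1: "finite D1"
    using h(3) finite_Bij_vimage[OF fB, of "beta l ` {..n}"] by (auto simp: D1_def break_set_def)
  have bf: "break_set D1 ?f" using break_set_mono[OF h(3) _ finD1] by (auto simp: D1_def)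
  have jeq: "j x = j y" if xy: "x \<in> unit_ival" "y \<in> unit_ival" "x \<le> y" and no: "{x<..y} \<inter> D1 = {}" for x y
  proof -
    have "{?f x<..?f y} \<inter> beta l ` {..n} = {}"
      using no by (intro break_set_image_disjoint[OF bf fB xy]) (auto simp: D1_def)
    moreover have "?f x \<le> ?f y" using break_setD[OF bf xy no] xy by simp
    ultimately show ?thesis
      unfolding j_def by (intro part_index_eq_of_no_beta[OF l] Bij_closed[OF fB] xy)
  qed
  have fix_iff: "(A [^]\<^bsub>ival_bij\<^esub> k) x = x \<longleftrightarrow> real (N * k) * a (j x) \<in> \<int>" if x: "x \<in> unit_ival" for k :: nat and x
  proof -
    have "h (rot n a l (real (N * k)) (?f x)) = x \<longleftrightarrow> rot n a l (real (N * k)) (?f x) = ?f x"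
      using hf(1)[OF x] hf(2)[OF rot_closed[OF l Bij_closed[OF fB x]]] by metis
    then show ?thesis using pow[OF x] rot_eq_self_iff[OF l part[OF x]] by simp
  qed
  have A1: "A [^]\<^bsub>ival_bij\<^esub> (1 :: nat) = A" using AB by (simp add: carrier_BijGroup)
  obtain D2 where D2: "break_set D2 A"
  proof -
    obtain D3 where D3: "break_set D3 ?s" using disjoint_rotation_break_set[OF l] by blast
    obtain D4 where D4: "break_set D4 (h \<otimes>\<^bsub>ival_bij\<^esub> ?s)"
      using break_set_comp[OF h(1,2) sB D3] by blast
    have hs: "h \<otimes>\<^bsub>ival_bij\<^esub> ?s \<in> Bij unit_ival"
      using C IB.m_closed by (simp add: carrier_BijGroup[symmetric])
    obtain D5 where D5: "break_set D5 (h \<otimes>\<^bsub>ival_bij\<^esub> ?s \<otimes>\<^bsub>ival_bij\<^esub> ?f)"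
      using break_set_comp[OF hs D4 fB h(3)] by blast
    have "h \<otimes>\<^bsub>ival_bij\<^esub> ?s \<otimes>\<^bsub>ival_bij\<^esub> ?f \<in> Bij unit_ival"
      using C IB.m_closed by (simp add: carrier_BijGroup[symmetric])
    then show ?thesis using that break_set_pow[OF _ D5] unfolding A_def by blast
  qed
  have "tame (D1 \<union> D2) A"
    unfolding tame_def
  proof (intro conjI ballI allI impI)
    show "break_set (D1 \<union> D2) A"
      by (rule break_set_mono[OF D2]) (use D2 finD1 in \<open>auto simp: break_set_def\<close>)
  next
    fix x and k :: nat assume x: "x \<in> unit_ival" "A x \<noteq> x" "k > 0"
    have "real N * a (j x) \<notin> \<int>" using fix_iff[OF x(1), of 1] x(2) A1 by simp
    then have "real (N * k) * a (j x) \<notin> \<int>" using N part[OF x(1)] x(3) by (metis nat_0_less_mult_iff)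
    then show "(A [^]\<^bsub>ival_bij\<^esub> k) x \<noteq> x" using fix_iff[OF x(1)] by simp
  next
    fix x y assume xy: "x \<in> unit_ival" "y \<in> unit_ival" "x \<le> y" "{x<..y} \<inter> (D1 \<union> D2) = {}"
    have "j x = j y" using xy by (intro jeq) auto
    then show "A x = x \<longleftrightarrow> A y = y" using fix_iff[OF xy(1), of 1] fix_iff[OF xy(2), of 1] A1 by simp
  next
    fix \<epsilon> :: real assume e: "\<epsilon> > 0"
    obtain k and m :: "nat \<Rightarrow> int" where k: "k > 0"
      "\<forall>i\<le>n. \<bar>real k * (real N * a i) - of_int (m i)\<bar> < \<epsilon>"
      using ex_simultaneous_approx[OF e, of n "\<lambda>i. real N * a i"] by blast
    \<comment> \<open>The length of the circle times the signed distance of the angle from its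
      approximating integer; lengths are at most 1, so \<epsilon> bounds it.\<close>
    define \<delta> where "\<delta> x = l (j x) * (real (N * k) * a (j x) - of_int (m (j x)))" for x
    have small: "\<bar>\<delta> x\<bar> < \<epsilon>" if x: "x \<in> unit_ival" for x
    proof -
      have i: "j x \<in> {1..n}" using part[OF x] by blast
      have l0: "0 < l i" if "i \<in> {1..n}" for i using l that by (simp add: Lambda_def)
      have "l (j x) \<le> sum l {1..n}"
        using l0 i by (intro member_le_sum) (auto intro: less_imp_le)
      then have l1: "0 < l (j x)" "l (j x) \<le> 1" using l0[OF i] l by (auto simp: Lambda_def)
      have "\<bar>real (N * k) * a (j x) - of_int (m (j x))\<bar> < \<epsilon>"
        using k(2) i by (simp add: mult_ac)
      moreover have "\<bar>\<delta> x\<bar> \<le> 1 * \<bar>real (N * k) * a (j x) - of_int (m (j x))\<bar>"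
        unfolding \<delta>_def abs_mult using l1 by (intro mult_right_mono) auto
      ultimately show ?thesis by simp
    qed
    have "small_shift (D1 \<union> D2) \<epsilon> \<delta> (A [^]\<^bsub>ival_bij\<^esub> k)"
      unfolding small_shift_def
    proof (intro conjI ballI allI impI)
      fix x y assume xy: "x \<in> unit_ival" "y \<in> unit_ival" "x \<le> y" "{x<..y} \<inter> (D1 \<union> D2) = {}"
      have "j x = j y" using xy by (intro jeq) auto
      then show "\<delta> x = \<delta> y" by (simp add: \<delta>_def)
    next
      fix x assume x: "x \<in> unit_ival" and far: "\<forall>d\<in>D1 \<union> D2. \<epsilon> \<le> \<bar>x - d\<bar>"
      let ?y = "x + \<delta> x"
      have "\<epsilon> \<le> \<bar>x - 0\<bar>" "\<epsilon> \<le> \<bar>x - 1\<bar>" using far unfolding D1_def by blast+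
      then have y: "?y \<in> unit_ival" using small[OF x] x by auto
      \<comment> \<open>No point of \<open>D1\<close> separates x from its shift, so both lie over
        the same circle and \<open>rot_shift\<close> will apply there. The sign of the shift decides
        which of them is the left end.\<close>
      have xy: "j ?y = j x \<and> ?f ?y - ?f x = \<delta> x"
      proof (cases "0 \<le> \<delta> x")
        case True
        have "{x<..?y} \<inter> D1 = {}" using far small[OF x] \<open>\<epsilon> > 0\<close> by (intro far_interval_disjoint[of D1 \<epsilon> x]) auto
        then show ?thesis using jeq[OF x y] break_setD[OF bf x y] True by simp
      next
        case False
        have "{?y<..x} \<inter> D1 = {}" using far small[OF x] \<open>\<epsilon> > 0\<close> by (intro far_interval_disjoint[of D1 \<epsilon> x]) auto
        then show ?thesis using jeq[OF y x] break_setD[OF bf y x] False by simp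
      qed
      have "rot n a l (real (N * k)) (?f x) = ?f x + \<delta> x"
      proof (rule rot_shift[OF l part[OF x], where m = "m (j x)"])
        show "?f x + \<delta> x \<in> part l (j x)" using part(2)[OF y] xy by (simp add: algebra_simps)
      qed (simp add: \<delta>_def)
      then have "rot n a l (real (N * k)) (?f x) = ?f ?y" using xy by simp
      then show "(A [^]\<^bsub>ival_bij\<^esub> k) x = ?y" using pow[OF x] hf(1)[OF y] by simp
    qed (use small in auto)
    then show "\<exists>k>0. \<exists>\<delta>. small_shift (D1 \<union> D2) \<epsilon> \<delta> (A [^]\<^bsub>ival_bij\<^esub> (k :: nat))"
      using k(1) by blast
  qed (use AB in auto)
  then show ?thesis by blast
qed

section \<open>One-sided germs\<close>

text \<open>The flag is \<open>True\<close> for right germs, which include the point \<open>d\<close> because exchanges are right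
  continuous, and \<open>False\<close> for left germs.\<close>

definition germ_nbhd :: "real \<Rightarrow> bool \<Rightarrow> real \<Rightarrow> real set" where
  "germ_nbhd d b e = (if b then {d..<d + e} else {d - e<..<d})"

text \<open>Taken as filters, germs are moved by exchanges through \<open>filtermap\<close>, "close
  enough to d" becomes \<open>eventually\<close>, and distinct germs have infimum
  \<open>bot\<close>.\<close>

definition germ :: "real \<Rightarrow> bool \<Rightarrow> real filter" where
  "germ d b = (INF e\<in>{0<..}. principal (germ_nbhd d b e))"

definition valid_germ :: "real \<Rightarrow> bool \<Rightarrow> bool" where
  "valid_germ d b \<longleftrightarrow> (if b then 0 \<le> d \<and> d < 1 else 0 < d \<and> d \<le> 1)"

definition germs :: "real filter set" where
  "germs = {germ d b | d b. valid_germ d b}"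

lemma eventually_germ: "eventually P (germ d b) \<longleftrightarrow> (\<exists>e>0. \<forall>x\<in>germ_nbhd d b e. P x)"
proof -
  have "eventually P (germ d b) \<longleftrightarrow> (\<exists>e\<in>{0<..}. eventually P (principal (germ_nbhd d b e)))"
    unfolding germ_def
  proof (rule eventually_INF_base)
    show "{0::real<..} \<noteq> {}" by (auto intro: exI[of _ 1])
    fix e e' :: real assume "e \<in> {0<..}" "e' \<in> {0<..}"
    then show "\<exists>x\<in>{0<..}. principal (germ_nbhd d b x) \<le>
        inf (principal (germ_nbhd d b e)) (principal (germ_nbhd d b e'))"
      by (intro bexI[of _ "min e e'"]) (auto simp: germ_nbhd_def)
  qed
  then show ?thesis by (auto simp: eventually_principal)
qed

lemma germ_neq_bot: "germ d b \<noteq> bot"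
proof -
  have "germ_nbhd d b e \<noteq> {}" if "e > 0" for e
    using that dense[of "d - e" d] by (auto simp: germ_nbhd_def)
  then show ?thesis
    unfolding trivial_limit_def eventually_germ by auto
qed

lemma germ_inf:
  assumes "d \<noteq> d' \<or> b \<noteq> b'"
  shows "inf (germ d b) (germ d' b') = bot"
proof -
  have "\<exists>e>0. germ_nbhd d b e \<inter> germ_nbhd d' b' e = {}"
  proof (cases "d = d'")
    case True
    then show ?thesis using assms by (intro exI[of _ 1]) (auto simp: germ_nbhd_def)
  next
    case False
    then show ?thesis by (intro exI[of _ "\<bar>d - d'\<bar> / 2"]) (auto simp: germ_nbhd_def field_simps abs_if)
  qed
  then obtain e where "e > 0" "germ_nbhd d b e \<inter> germ_nbhd d' b' e = {}" by blast
  then have "eventually (\<lambda>_. False) (inf (germ d b) (germ d' b'))"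
    unfolding eventually_inf
    by (intro exI[of _ "\<lambda>x. x \<in> germ_nbhd d b e"] exI[of _ "\<lambda>x. x \<in> germ_nbhd d' b' e"])
       (auto simp: eventually_germ)
  then show ?thesis by (simp add: trivial_limit_def)
qed

lemma germ_eq_iff: "germ d b = germ d' b' \<longleftrightarrow> d = d' \<and> b = b'"
proof (intro iffI, rule ccontr)
  assume eq: "germ d b = germ d' b'" and "\<not> (d = d' \<and> b = b')"
  then have "inf (germ d b) (germ d' b') = bot" by (intro germ_inf) blast
  then show False using germ_neq_bot[of d b] unfolding eq[symmetric] by simp
qed simp

section \<open>The action of exchanges on germs\<close>

lemma filtermap_cong:
  assumes "eventually (\<lambda>x. f x = g x) F"
  shows "filtermap f F = filtermap g F"
proof -
  have "eventually (\<lambda>x. P (f x)) F \<longleftrightarrow> eventually (\<lambda>x. P (g x)) F" for P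
    by (rule eventually_cong) (use assms in \<open>auto elim: eventually_mono\<close>)
  then show ?thesis by (simp add: filter_eq_iff eventually_filtermap)
qed

lemma filtermap_germ:
  assumes "eventually (\<lambda>x. f x = x + t) (germ d b)"
  shows "filtermap f (germ d b) = germ (d + t) b"
proof -
  have nb: "(\<forall>x\<in>germ_nbhd d b e. P (x + t)) \<longleftrightarrow> (\<forall>x\<in>germ_nbhd (d + t) b e. P x)" for e P
  proof -
    have "x \<in> germ_nbhd (d + t) b e \<longleftrightarrow> x - t \<in> germ_nbhd d b e" for x
      by (auto simp: germ_nbhd_def)
    then show ?thesis by (metis add_diff_cancel_right' diff_add_cancel)
  qed
  have "filtermap f (germ d b) = filtermap (\<lambda>x. x + t) (germ d b)"
    by (rule filtermap_cong) (use assms in auto)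
  also have "\<dots> = germ (d + t) b"
    unfolding filter_eq_iff eventually_filtermap eventually_germ nb by simp
  finally show ?thesis .
qed

lemma germ_interval:
  assumes D: "finite D" and v: "valid_germ d b"
  obtains e where "e > 0" "germ_nbhd d b e \<subseteq> unit_ival"
    and "\<And>x y. x \<in> germ_nbhd d b e \<Longrightarrow> y \<in> germ_nbhd d b e \<Longrightarrow> {x<..y} \<inter> D = {}"
proof -
  obtain e1 where e1: "e1 > 0" "\<And>z. z \<in> D \<Longrightarrow> z \<noteq> d \<Longrightarrow> e1 \<le> dist d z"
    using finite_set_avoid[OF D, of d] by blast
  define e where "e = min e1 (if b then 1 - d else d)"
  show ?thesis
  proof
    show "e > 0" "germ_nbhd d b e \<subseteq> unit_ival"
      using v e1 by (auto simp: e_def valid_germ_def germ_nbhd_def split: if_splits)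
    fix x y assume xy: "x \<in> germ_nbhd d b e" "y \<in> germ_nbhd d b e"
    show "{x<..y} \<inter> D = {}"
    proof (rule ccontr)
      assume "{x<..y} \<inter> D \<noteq> {}"
      then obtain z where z: "x < z" "z \<le> y" "z \<in> D" by auto
      then have "z \<noteq> d" "dist d z < e"
        using xy by (auto simp: germ_nbhd_def dist_real_def split: if_splits)
      then show False using e1(2)[OF z(3)] by (simp add: e_def)
    qed
  qed
qed

lemma germ_const:
  assumes D: "finite D" and v: "valid_germ d b"
    and \<phi>: "\<And>x y. x \<in> unit_ival \<Longrightarrow> y \<in> unit_ival \<Longrightarrow> x \<le> y \<Longrightarrow> {x<..y} \<inter> D = {} \<Longrightarrow> \<phi> x = \<phi> y"
  shows "\<exists>c. eventually (\<lambda>x. \<phi> x = c) (germ d b)"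
proof -
  obtain e where e: "e > 0" "germ_nbhd d b e \<subseteq> unit_ival"
    "\<And>x y. x \<in> germ_nbhd d b e \<Longrightarrow> y \<in> germ_nbhd d b e \<Longrightarrow> {x<..y} \<inter> D = {}"
    using germ_interval[OF D v] by blast
  \<comment> \<open>A left germ does not contain its base point, hence the interior reference
    point.\<close>
  define p where "p = (if b then d else d - e / 2)"
  have p: "p \<in> germ_nbhd d b e" using e(1) by (auto simp: p_def germ_nbhd_def)
  have "\<phi> x = \<phi> p" if x: "x \<in> germ_nbhd d b e" for x
  proof (cases "x \<le> p")
    case True
    then show ?thesis using \<phi>[of x p] e(2) e(3)[OF x p] x p by blast
  next
    case False
    then show ?thesis using \<phi>[of p x] e(2) e(3)[OF p x] x p by fastforce
  qed
  then show ?thesis using e(1) unfolding eventually_germ by blast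
qed

lemma eventually_unit_ival: "F \<in> germs \<Longrightarrow> eventually (\<lambda>x. x \<in> unit_ival) F"
proof -
  assume "F \<in> germs"
  then obtain d b where F: "F = germ d b" "valid_germ d b" by (auto simp: germs_def)
  obtain e where "e > 0" "germ_nbhd d b e \<subseteq> unit_ival"
    using germ_interval[OF finite.emptyI F(2)] .
  then show ?thesis unfolding F(1) eventually_germ by blast
qed

lemma germs_neq_bot: "F \<in> germs \<Longrightarrow> F \<noteq> bot"
  using germ_neq_bot by (auto simp: germs_def)

lemma germs_inf: "F \<in> germs \<Longrightarrow> F' \<in> germs \<Longrightarrow> F \<noteq> F' \<Longrightarrow> inf F F' = bot"
proof -
  assume "F \<in> germs" "F' \<in> germs" "F \<noteq> F'"
  then obtain d b d' b' where F: "F = germ d b" "F' = germ d' b'" by (auto simp: germs_def)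
  then have "d \<noteq> d' \<or> b \<noteq> b'" using \<open>F \<noteq> F'\<close> by blast
  then show ?thesis unfolding F by (rule germ_inf)
qed

lemma break_set_germ:
  assumes f: "f \<in> Bij unit_ival" "break_set D f" and v: "valid_germ d b"
  shows "\<exists>t. eventually (\<lambda>x. f x = x + t) (germ d b) \<and> valid_germ (d + t) b"
proof -
  have "f x - x = f y - y"
    if "x \<in> unit_ival" "y \<in> unit_ival" "x \<le> y" "{x<..y} \<inter> D = {}" for x y
    using break_setD[OF f(2) that] by simp
  then have "\<exists>t. eventually (\<lambda>x. f x - x = t) (germ d b)"
    by (rule germ_const[OF break_set_finite[OF f(2)] v])
  then obtain t where t: "eventually (\<lambda>x. f x = x + t) (germ d b)"
    by (auto simp: diff_eq_eq add.commute)
  have "eventually (\<lambda>x. x \<in> unit_ival) (germ d b)"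
    using eventually_unit_ival v by (auto simp: germs_def)
  with t have "eventually (\<lambda>x. x + t \<in> unit_ival) (germ d b)"
    by eventually_elim (metis Bij_closed f(1))
  then obtain e where e: "e > 0" "\<And>x. x \<in> germ_nbhd d b e \<Longrightarrow> x + t \<in> unit_ival"
    unfolding eventually_germ by blast
  have "valid_germ (d + t) b"
  proof (cases b)
    case True
    then show ?thesis using e(2)[of d] e(1) by (simp add: valid_germ_def germ_nbhd_def)
  next
    case False
    have "d + t \<le> 1"
    proof (rule ccontr)
      assume "\<not> d + t \<le> 1"
      \<comment> \<open>Small enough for d - m to stay in the neighbourhood, yet its image d - m + t
        is still at least 1.\<close>
      define m where "m = min (e / 2) (d + t - 1)"
      have m: "0 < m" "m < e" "m \<le> d + t - 1"
        using \<open>\<not> d + t \<le> 1\<close> e(1) by (auto simp: m_def)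
      have "d - m \<in> germ_nbhd d b e" using m False by (simp add: germ_nbhd_def)
      then show False using e(2)[of "d - m"] m by simp
    qed
    then show ?thesis using e(2)[of "d - e / 2"] e(1) False by (simp add: valid_germ_def germ_nbhd_def)
  qed
  with t show ?thesis by blast
qed

lemma filtermap_germs:
  assumes "f \<in> Bij unit_ival" "break_set D f" "F \<in> germs"
  shows "filtermap f F \<in> germs"
  using assms(3) break_set_germ[OF assms(1,2)] filtermap_germ unfolding germs_def by blast

lemma filtermap_mult:
  assumes "f \<in> Bij unit_ival" "g \<in> Bij unit_ival" "F \<in> germs"
  shows "filtermap (f \<otimes>\<^bsub>ival_bij\<^esub> g) F = filtermap f (filtermap g F)"
  unfolding filtermap_filtermap
  using eventually_mono[OF eventually_unit_ival[OF assms(3)]] BijGroup_mult_apply[OF assms(1,2)]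
  by (intro filtermap_cong) auto

lemma filtermap_pow_germs:
  "f \<in> Bij unit_ival \<Longrightarrow> break_set D f \<Longrightarrow> F \<in> germs \<Longrightarrow> filtermap (f [^]\<^bsub>ival_bij\<^esub> (k :: nat)) F \<in> germs"
  using break_set_pow[of f D k] Bij_pow filtermap_germs by metis

lemma tame_germ_cases:
  assumes "tame D A" "F \<in> germs"
  shows "eventually (\<lambda>x. A x = x) F \<or> eventually (\<lambda>x. A x \<noteq> x) F"
proof -
  obtain d b where F: "F = germ d b" "valid_germ d b" using assms(2) by (auto simp: germs_def)
  have "finite D" by (rule break_set_finite[OF tameD(2)[OF assms(1)]])
  then obtain c where "eventually (\<lambda>x. (A x = x) = c) F"
    using germ_const[OF _ F(2), of D "\<lambda>x. A x = x"] tameD(4)[OF assms(1)] F(1) by blast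
  then show ?thesis by (cases c) auto
qed

text \<open>The power translates the germ by some t. If t were 0, the points of the germ would be
  periodic although \<open>A\<close> moves them, which tameness excludes.\<close>

lemma filtermap_pow_moved:
  assumes A: "tame D A" and F: "F \<in> germs" and mv: "eventually (\<lambda>x. A x \<noteq> x) F" and k: "k > 0"
  shows "filtermap (A [^]\<^bsub>ival_bij\<^esub> (k :: nat)) F \<noteq> F"
proof -
  obtain d b where db: "F = germ d b" "valid_germ d b" using F by (auto simp: germs_def)
  obtain E where "break_set E (A [^]\<^bsub>ival_bij\<^esub> k)" using break_set_pow tameD(1,2)[OF A] by blast
  then obtain t where t: "eventually (\<lambda>x. (A [^]\<^bsub>ival_bij\<^esub> k) x = x + t) F"
    using break_set_germ[OF Bij_pow[OF tameD(1)[OF A]] _ db(2)] db(1) by blast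
  have "eventually (\<lambda>x. t \<noteq> 0) F"
    using t mv eventually_unit_ival[OF F]
  proof eventually_elim
    case (elim x)
    then show ?case using tameD(3)[OF A elim(3,2) k] by auto
  qed
  then have "t \<noteq> 0" using germs_neq_bot[OF F] by simp
  moreover have "filtermap (A [^]\<^bsub>ival_bij\<^esub> k) F = germ (d + t) b"
    using filtermap_germ t db(1) by simp
  ultimately show ?thesis using db(1) by (simp add: germ_eq_iff)
qed

lemma filtermap_pow_fixed:
  assumes A: "tame D A" and F: "F \<in> germs" and "eventually (\<lambda>x. A x = x) F"
  shows "filtermap (A [^]\<^bsub>ival_bij\<^esub> (k :: nat)) F = F"
proof -
  have "eventually (\<lambda>x. (A [^]\<^bsub>ival_bij\<^esub> k) x = x) F"
    using assms(3) eventually_unit_ival[OF F]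
    by eventually_elim (rule pow_fixed[OF tameD(1)[OF A]])
  then have "filtermap (A [^]\<^bsub>ival_bij\<^esub> k) F = filtermap (\<lambda>x. x) F"
    by (intro filtermap_cong) auto
  then show ?thesis by (simp add: filtermap_ident)
qed

text \<open>\<open>A\<close> commutes with \<open>A^k\<close>, so by injectivity a point is fixed by
  \<open>A\<close> once its image under \<open>A^k\<close> is. Hence \<open>A\<close> fixes F as
  well, and \<open>A^k\<close> leaves F in place.\<close>

lemma filtermap_pow_eq_fixed:
  assumes A: "tame D A" and F: "F \<in> germs" "F' \<in> germs" and fx: "eventually (\<lambda>x. A x = x) F'"
    and eq: "filtermap (A [^]\<^bsub>ival_bij\<^esub> (k :: nat)) F = F'"
  shows "F = F'"
proof (cases "eventually (\<lambda>x. A x = x) F")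
  case True
  then show ?thesis using filtermap_pow_fixed[OF A F(1)] eq by simp
next
  case False
  note AB = tameD(1)[OF A]
  have "eventually (\<lambda>x. A x \<noteq> x) F" using False tame_germ_cases[OF A F(1)] by blast
  moreover have "eventually (\<lambda>x. A ((A [^]\<^bsub>ival_bij\<^esub> k) x) = (A [^]\<^bsub>ival_bij\<^esub> k) x) F"
    using fx unfolding eq[symmetric] eventually_filtermap .
  ultimately have "eventually (\<lambda>x. False) F" using eventually_unit_ival[OF F(1)]
  proof eventually_elim
    case (elim x)
    have "A ((A [^]\<^bsub>ival_bij\<^esub> k) x) = (A [^]\<^bsub>ival_bij\<^esub> Suc k) x"
      using BijGroup_mult_apply[OF AB Bij_pow[OF AB] elim(3)] AB
      by (subst IB.nat_pow_Suc2) (simp_all add: carrier_BijGroup)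
    also have "\<dots> = (A [^]\<^bsub>ival_bij\<^esub> k) (A x)"
      using BijGroup_mult_apply[OF Bij_pow[OF AB] AB elim(3)] by simp
    finally have "(A [^]\<^bsub>ival_bij\<^esub> k) (A x) = (A [^]\<^bsub>ival_bij\<^esub> k) x" using elim(2) by metis
    then have "A x = x" by (rule Bij_inj[OF Bij_pow[OF AB] Bij_closed[OF AB elim(3)] elim(3)])
    then show ?case using elim(1) by simp
  qed
  then show ?thesis using germs_neq_bot[OF F(1)] by simp
qed

text \<open>There is at most one hit: two would give a positive power of \<open>A\<close> that fixes
  the moved germ F'.\<close>

lemma finite_hits:
  assumes A: "tame D A" and F: "F \<in> germs" "F' \<in> germs" and mv: "eventually (\<lambda>x. A x \<noteq> x) F'"
  shows "finite {k :: nat. filtermap (A [^]\<^bsub>ival_bij\<^esub> k) F = F'}" (is "finite ?S")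
proof -
  note AB = tameD(1)[OF A]
  have "\<not> i < k" if "i \<in> ?S" "k \<in> ?S" for i k
  proof
    assume "i < k"
    then have "A [^]\<^bsub>ival_bij\<^esub> k = A [^]\<^bsub>ival_bij\<^esub> (k - i) \<otimes>\<^bsub>ival_bij\<^esub> A [^]\<^bsub>ival_bij\<^esub> i"
      using AB by (simp add: IB.nat_pow_mult carrier_BijGroup)
    then have "filtermap (A [^]\<^bsub>ival_bij\<^esub> (k - i)) F' = F'"
      using that filtermap_mult[OF Bij_pow[OF AB, of "k - i"] Bij_pow[OF AB, of i] F(1)] by simp
    then show False using filtermap_pow_moved[OF A F(2) mv, of "k - i"] \<open>i < k\<close> by simp
  qed
  then have "\<forall>i\<in>?S. \<forall>k\<in>?S. i = k" by (metis linorder_neqE_nat)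
  then have "?S \<subseteq> {SOME k. k \<in> ?S}" by (metis (mono_tags, lifting) singletonI someI subsetI)
  then show ?thesis by (rule finite_subset) simp
qed

section \<open>Displacing finitely many moved germs and their neighbourhoods\<close>

lemma move_germs:
  assumes A: "tame D A" and B: "tame E B" and fin: "finite \<Gamma>" and \<Gamma>: "\<Gamma> \<subseteq> germs"
    and mv: "\<And>F. F \<in> \<Gamma> \<Longrightarrow> eventually (\<lambda>x. A x \<noteq> x) F \<or> eventually (\<lambda>x. B x \<noteq> x) F"
  obtains i k j :: nat where "i < k" "0 < j"
    and "\<And>p F F'. p \<in> {i, k} \<Longrightarrow> F \<in> \<Gamma> \<Longrightarrow> F' \<in> \<Gamma> \<Longrightarrow>
      filtermap (A [^]\<^bsub>ival_bij\<^esub> p \<otimes>\<^bsub>ival_bij\<^esub> B [^]\<^bsub>ival_bij\<^esub> j) F \<noteq> F'"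
proof -
  note AB = tameD(1)[OF A] tameD(1)[OF B]
  \<comment> \<open>A germ fixed by \<open>A\<close> can only be hit if \<open>B\<^sup>j\<close> already hits it, which rules out finitely
    many \<open>j\<close>; once \<open>j\<close> is chosen, a germ moved by \<open>A\<close> is hit for finitely many \<open>i\<close>.\<close>
  define J where "J = (\<Union>F\<in>\<Gamma>. \<Union>F'\<in>{F' \<in> \<Gamma>. eventually (\<lambda>x. B x \<noteq> x) F'}.
    {j :: nat. filtermap (B [^]\<^bsub>ival_bij\<^esub> j) F = F'})"
  have "finite J"
    unfolding J_def using fin \<Gamma> by (intro finite_UN_I finite_hits[OF B]) auto
  \<comment> \<open>Zero is excluded too, because the algebra extracts a root from
    \<open>B^j\<close>.\<close>
  then obtain j where j: "j \<notin> insert 0 J" by (metis ex_new_if_finite finite_insert infinite_UNIV_nat)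
  have BF: "filtermap (B [^]\<^bsub>ival_bij\<^esub> j) F \<in> germs" if "F \<in> \<Gamma>" for F
    using filtermap_pow_germs[OF tameD(1,2)[OF B]] that \<Gamma> by blast
  define I where "I = (\<Union>F\<in>\<Gamma>. \<Union>F'\<in>{F' \<in> \<Gamma>. eventually (\<lambda>x. A x \<noteq> x) F'}.
    {i :: nat. filtermap (A [^]\<^bsub>ival_bij\<^esub> i) (filtermap (B [^]\<^bsub>ival_bij\<^esub> j) F) = F'})"
  have finI: "finite I"
    unfolding I_def using fin \<Gamma> BF by (intro finite_UN_I finite_hits[OF A]) auto
  then obtain i where i: "i \<notin> I" by (metis ex_new_if_finite infinite_UNIV_nat)
  obtain k where k: "k \<notin> I \<union> {..i}"
    by (metis ex_new_if_finite infinite_UNIV_nat finI finite_UnI finite_atMost)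
  have ne: "filtermap (A [^]\<^bsub>ival_bij\<^esub> p \<otimes>\<^bsub>ival_bij\<^esub> B [^]\<^bsub>ival_bij\<^esub> j) F \<noteq> F'"
    if p: "p \<notin> I" and F: "F \<in> \<Gamma>" "F' \<in> \<Gamma>" for p F F'
  proof
    assume "filtermap (A [^]\<^bsub>ival_bij\<^esub> p \<otimes>\<^bsub>ival_bij\<^esub> B [^]\<^bsub>ival_bij\<^esub> j) F = F'"
    then have eq: "filtermap (A [^]\<^bsub>ival_bij\<^esub> p) (filtermap (B [^]\<^bsub>ival_bij\<^esub> j) F) = F'"
      using filtermap_mult[OF Bij_pow[OF AB(1)] Bij_pow[OF AB(2)], of F] F(1) \<Gamma> by auto
    have nA: "\<not> eventually (\<lambda>x. A x \<noteq> x) F'" using p eq F by (auto simp: I_def)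
    then have "eventually (\<lambda>x. A x = x) F'" using tame_germ_cases[OF A] F \<Gamma> by blast
    then have "filtermap (B [^]\<^bsub>ival_bij\<^esub> j) F = F'"
      using filtermap_pow_eq_fixed[OF A BF[OF F(1)] _ _ eq] F \<Gamma> by blast
    then show False using mv[OF F(2)] nA j F by (auto simp: J_def)
  qed
  show thesis
  proof (rule that)
    show "i < k" "0 < j" using k j by auto
    fix p F F' assume "p \<in> {i, k}" "F \<in> \<Gamma>" "F' \<in> \<Gamma>"
    moreover have "i \<notin> I" "k \<notin> I" using i k by auto
    ultimately show "filtermap (A [^]\<^bsub>ival_bij\<^esub> p \<otimes>\<^bsub>ival_bij\<^esub> B [^]\<^bsub>ival_bij\<^esub> j) F \<noteq> F'"
      using ne by blast
  qed
qed

lemma germs_separation: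
  assumes w: "w \<in> Bij unit_ival" "break_set E w" and fin: "finite \<Gamma>" and \<Gamma>: "\<Gamma> \<subseteq> germs"
    and ne: "\<And>F F'. F \<in> \<Gamma> \<Longrightarrow> F' \<in> \<Gamma> \<Longrightarrow> filtermap w F \<noteq> F'"
  shows "\<exists>U. (\<forall>F\<in>\<Gamma>. eventually (\<lambda>x. x \<in> U) F) \<and> (\<forall>x\<in>U. w x \<notin> U)"
proof -
  have "\<exists>P Q. eventually P (filtermap w F) \<and> eventually Q F' \<and> (\<forall>x. P x \<longrightarrow> Q x \<longrightarrow> False)"
    if "F \<in> \<Gamma>" "F' \<in> \<Gamma>" for F F'
  proof -
    have "inf (filtermap w F) F' = bot"
      using germs_inf[OF filtermap_germs[OF w]] that \<Gamma> ne by blast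
    then have "eventually (\<lambda>_. False) (inf (filtermap w F) F')" by simp
    then show ?thesis unfolding eventually_inf by blast
  qed
  then obtain P Q where PQ: "\<And>F F'. F \<in> \<Gamma> \<Longrightarrow> F' \<in> \<Gamma> \<Longrightarrow>
      eventually (P F F') (filtermap w F) \<and> eventually (Q F F') F' \<and> (\<forall>x. P F F' x \<longrightarrow> Q F F' x \<longrightarrow> False)"
    by metis
  \<comment> \<open>If x lies in \<open>U\<close> through F and w x through F', then w x satisfies
    both \<open>P F F'\<close> and \<open>Q F F'\<close>, which exclude each other.\<close>
  define U where "U = {x. \<exists>F\<in>\<Gamma>. \<forall>F'\<in>\<Gamma>. P F F' (w x) \<and> Q F' F x}"
  have "eventually (\<lambda>x. x \<in> U) F" if F: "F \<in> \<Gamma>" for F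
  proof -
    have "eventually (\<lambda>x. \<forall>F'\<in>\<Gamma>. P F F' (w x) \<and> Q F' F x) F"
      using PQ F fin by (auto intro!: eventually_ball_finite eventually_conj simp: eventually_filtermap)
    then show ?thesis by eventually_elim (use F in \<open>auto simp: U_def\<close>)
  qed
  moreover have "w x \<notin> U" if "x \<in> U" for x
    using that PQ unfolding U_def by blast
  ultimately show ?thesis by blast
qed

text \<open>Each side of a point of \<open>D\<close> is one germ: it is covered by \<open>U\<close>
  if one of the maps moves it, and otherwise both maps fix it. Finiteness of \<open>D\<close> makes
  the radius uniform.\<close>

lemma moved_germs_nbhd:
  assumes A: "tame D A" and B: "tame D B"
    and U: "\<And>d b. d \<in> D \<Longrightarrow> valid_germ d b \<Longrightarrow>
      eventually (\<lambda>x. A x \<noteq> x) (germ d b) \<or> eventually (\<lambda>x. B x \<noteq> x) (germ d b) \<Longrightarrow>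
      eventually (\<lambda>x. x \<in> U) (germ d b)"
  shows "\<exists>\<epsilon>>0. \<forall>x\<in>unit_ival. \<forall>d\<in>D. \<bar>x - d\<bar> < \<epsilon> \<longrightarrow> x \<in> U \<or> A x = x \<and> B x = x"
proof -
  have "\<exists>e>0. \<forall>x\<in>unit_ival. \<bar>x - d\<bar> < e \<longrightarrow> x \<in> U \<or> A x = x \<and> B x = x" if d: "d \<in> D" for d
  proof -
    let ?P = "\<lambda>x. x \<in> U \<or> A x = x \<and> B x = x"
    have "\<exists>e>0. \<forall>x\<in>unit_ival \<inter> germ_nbhd d b e. ?P x" for b
    proof (cases "valid_germ d b")
      case True
      then have g: "germ d b \<in> germs" by (auto simp: germs_def)
      have "eventually ?P (germ d b)"
      proof (cases "eventually (\<lambda>x. A x = x) (germ d b) \<and> eventually (\<lambda>x. B x = x) (germ d b)")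
        case True
        then show ?thesis by (auto intro: eventually_elim2)
      next
        case False
        then have "eventually (\<lambda>x. x \<in> U) (germ d b)"
          using U[OF d \<open>valid_germ d b\<close>] tame_germ_cases[OF A g] tame_germ_cases[OF B g] by blast
        then show ?thesis by (rule eventually_mono) simp
      qed
      then show ?thesis unfolding eventually_germ by blast
    next
      case False
      show ?thesis
      \<comment> \<open>An invalid germ lies outside the interval; with this radius its
        neighbourhood misses \<open>unit_ival\<close> and the claim is vacuous.\<close>
      proof (intro exI[of _ "if b then (if d < 0 then - d else 1) else (if d > 1 then d - 1 else 1)"] conjI)
        show "\<forall>x\<in>unit_ival \<inter> germ_nbhd d b
            (if b then (if d < 0 then - d else 1) else (if d > 1 then d - 1 else 1)). ?P x"
          using False by (auto simp: valid_germ_def germ_nbhd_def split: if_splits)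
      qed simp
    qed
    then obtain e1 e2 where e: "e1 > 0" "\<forall>x\<in>unit_ival \<inter> germ_nbhd d True e1. ?P x"
      "e2 > 0" "\<forall>x\<in>unit_ival \<inter> germ_nbhd d False e2. ?P x" by metis
    show ?thesis
    proof (intro exI[of _ "min e1 e2"] conjI ballI impI)
      fix x assume x: "x \<in> unit_ival" "\<bar>x - d\<bar> < min e1 e2"
      then have "x \<in> germ_nbhd d True e1 \<or> x \<in> germ_nbhd d False e2"
        by (auto simp: germ_nbhd_def)
      then show "?P x" using e x by blast
    qed (use e in auto)
  qed
  then obtain e where e: "\<And>d. d \<in> D \<Longrightarrow> e d > 0"
    "\<And>d x. d \<in> D \<Longrightarrow> x \<in> unit_ival \<Longrightarrow> \<bar>x - d\<bar> < e d \<Longrightarrow> x \<in> U \<or> A x = x \<and> B x = x"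
    by metis
  have fin: "finite D" by (rule break_set_finite[OF tameD(2)[OF A]])
  show ?thesis
  proof (intro exI[of _ "Min (insert 1 (e ` D))"] conjI ballI impI)
    show "Min (insert 1 (e ` D)) > 0" using fin e(1) by simp
    fix x d assume x: "x \<in> unit_ival" "d \<in> D" "\<bar>x - d\<bar> < Min (insert 1 (e ` D))"
    then have "\<bar>x - d\<bar> < e d" using fin by simp
    then show "x \<in> U \<or> A x = x \<and> B x = x" using e(2) x by blast
  qed
qed

section \<open>Commutators with small support\<close>

lemma small_shiftD:
  assumes "small_shift D \<epsilon> \<delta> f"
  shows "x \<in> unit_ival \<Longrightarrow> \<bar>\<delta> x\<bar> < \<epsilon>"
    and "x \<in> unit_ival \<Longrightarrow> y \<in> unit_ival \<Longrightarrow> x \<le> y \<Longrightarrow> {x<..y} \<inter> D = {} \<Longrightarrow> \<delta> x = \<delta> y"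
    and "x \<in> unit_ival \<Longrightarrow> \<forall>d\<in>D. \<epsilon> \<le> \<bar>x - d\<bar> \<Longrightarrow> f x = x + \<delta> x"
  using assms unfolding small_shift_def by blast+

text \<open>Two shifts move a point by less than 2 \<epsilon> in total. Starting at distance 4
  \<epsilon> from \<open>D\<close>, every intermediate point is still at least \<epsilon> away and
  has the displacement of x.\<close>

lemma small_shift_near:
  assumes f: "small_shift D \<epsilon> \<delta> f" and D: "0 \<in> D" "1 \<in> D" and x: "x \<in> unit_ival"
    and far: "\<forall>d\<in>D. 4 * \<epsilon> \<le> \<bar>x - d\<bar>" and z: "\<bar>z - x\<bar> < 2 * \<epsilon>"
  shows "z \<in> unit_ival" "f z = z + \<delta> x"
proof -
  have e: "\<epsilon> > 0" using z by simp
  have "4 * \<epsilon> \<le> \<bar>x - 0\<bar>" "4 * \<epsilon> \<le> \<bar>x - 1\<bar>" using far D by blast+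
  then show zi: "z \<in> unit_ival" using x z by (auto simp: abs_if split: if_splits)
  have "\<forall>d\<in>D. \<epsilon> \<le> \<bar>z - d\<bar>"
  proof
    fix d assume "d \<in> D"
    then show "\<epsilon> \<le> \<bar>z - d\<bar>" using far[rule_format, of d] z by linarith
  qed
  then have "f z = z + \<delta> z" by (rule small_shiftD(3)[OF f zi])
  moreover have "\<delta> z = \<delta> x"
  proof (cases "z \<le> x")
    case True
    have "{z<..x} \<inter> D = {}" by (rule far_interval_disjoint[OF far]) (use z e in auto)
    then show ?thesis by (rule small_shiftD(2)[OF f zi x True])
  next
    case False
    have "{x<..z} \<inter> D = {}" by (rule far_interval_disjoint[OF far]) (use z e in auto)
    then show ?thesis using small_shiftD(2)[OF f x zi] False by simp
  qed
  ultimately show "f z = z + \<delta> x" by simp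
qed

text \<open>Subtracting both displacements from x gives a point that either order of the maps sends
  to x. A common preimage is what shows that the commutator fixes x.\<close>

lemma small_shifts_commute:
  assumes f: "small_shift D \<epsilon> \<delta> f" and g: "small_shift D \<epsilon> \<gamma> g" and D: "0 \<in> D" "1 \<in> D"
    and x: "x \<in> unit_ival" and far: "\<forall>d\<in>D. 4 * \<epsilon> \<le> \<bar>x - d\<bar>"
  shows "\<exists>y\<in>unit_ival. g (f y) = x \<and> f (g y) = x"
proof -
  let ?y = "x - \<delta> x - \<gamma> x"
  have b: "\<bar>\<delta> x\<bar> < \<epsilon>" "\<bar>\<gamma> x\<bar> < \<epsilon>" using small_shiftD(1)[OF f x] small_shiftD(1)[OF g x] .
  note F = small_shift_near[OF f D x far] and G = small_shift_near[OF g D x far]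
  have "f ?y = x - \<gamma> x" "g ?y = x - \<delta> x"
    using F(2)[of ?y] G(2)[of ?y] b by auto
  moreover have "g (x - \<gamma> x) = x" "f (x - \<delta> x) = x"
    using F(2)[of "x - \<delta> x"] G(2)[of "x - \<gamma> x"] b by auto
  moreover have "?y \<in> unit_ival" using F(1)[of ?y] b by auto
  ultimately show ?thesis by metis
qed

lemma tame_commutator_law:
  assumes A: "tame D A" and B: "tame D B" and D: "0 \<in> D" "1 \<in> D"
  obtains i k j n m :: nat and c d d'
  where "i < k" "0 < j" "0 < n" "0 < m" "c \<in> Bij unit_ival" "d \<in> Bij unit_ival" "d' \<in> Bij unit_ival"
    "c \<otimes>\<^bsub>ival_bij\<^esub> (B [^]\<^bsub>ival_bij\<^esub> m \<otimes>\<^bsub>ival_bij\<^esub> A [^]\<^bsub>ival_bij\<^esub> n) = A [^]\<^bsub>ival_bij\<^esub> n \<otimes>\<^bsub>ival_bij\<^esub> B [^]\<^bsub>ival_bij\<^esub> m"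
    "(A [^]\<^bsub>ival_bij\<^esub> i \<otimes>\<^bsub>ival_bij\<^esub> B [^]\<^bsub>ival_bij\<^esub> j) \<otimes>\<^bsub>ival_bij\<^esub> c = d \<otimes>\<^bsub>ival_bij\<^esub> (A [^]\<^bsub>ival_bij\<^esub> i \<otimes>\<^bsub>ival_bij\<^esub> B [^]\<^bsub>ival_bij\<^esub> j)"
    "c \<otimes>\<^bsub>ival_bij\<^esub> d = d \<otimes>\<^bsub>ival_bij\<^esub> c"
    "(A [^]\<^bsub>ival_bij\<^esub> k \<otimes>\<^bsub>ival_bij\<^esub> B [^]\<^bsub>ival_bij\<^esub> j) \<otimes>\<^bsub>ival_bij\<^esub> c = d' \<otimes>\<^bsub>ival_bij\<^esub> (A [^]\<^bsub>ival_bij\<^esub> k \<otimes>\<^bsub>ival_bij\<^esub> B [^]\<^bsub>ival_bij\<^esub> j)"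
    "c \<otimes>\<^bsub>ival_bij\<^esub> d' = d' \<otimes>\<^bsub>ival_bij\<^esub> c"
proof -
  note AB = tameD(1)[OF A] tameD(1)[OF B]
  have finD: "finite D" by (rule break_set_finite[OF tameD(2)[OF A]])
  define \<Gamma> where "\<Gamma> = {F \<in> (\<lambda>(d, b). germ d b) ` (D \<times> UNIV). F \<in> germs \<and>
    (eventually (\<lambda>x. A x \<noteq> x) F \<or> eventually (\<lambda>x. B x \<noteq> x) F)}"
  have \<Gamma>: "finite \<Gamma>" "\<Gamma> \<subseteq> germs" using finD by (auto simp: \<Gamma>_def)
  have mv: "eventually (\<lambda>x. A x \<noteq> x) F \<or> eventually (\<lambda>x. B x \<noteq> x) F" if "F \<in> \<Gamma>" for F
    using that by (simp add: \<Gamma>_def)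
  obtain i k j :: nat where ikj: "i < k" "0 < j"
    and ne: "\<And>p F F'. p \<in> {i, k} \<Longrightarrow> F \<in> \<Gamma> \<Longrightarrow> F' \<in> \<Gamma> \<Longrightarrow>
      filtermap (A [^]\<^bsub>ival_bij\<^esub> p \<otimes>\<^bsub>ival_bij\<^esub> B [^]\<^bsub>ival_bij\<^esub> j) F \<noteq> F'"
    using move_germs[OF A B \<Gamma> mv] by metis
  define w where "w p = A [^]\<^bsub>ival_bij\<^esub> p \<otimes>\<^bsub>ival_bij\<^esub> B [^]\<^bsub>ival_bij\<^esub> j" for p :: nat
  have w: "w p \<in> Bij unit_ival" for p
    using IB.m_closed Bij_pow[OF AB(1)] Bij_pow[OF AB(2)] by (simp add: w_def carrier_BijGroup)
  have "\<exists>E. break_set E (w p)" for p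
    using break_set_pow[OF AB(1) tameD(2)[OF A], of p] break_set_pow[OF AB(2) tameD(2)[OF B], of j]
      break_set_comp[OF Bij_pow[OF AB(1)] _ Bij_pow[OF AB(2)]] unfolding w_def by blast
  then have "\<exists>U. (\<forall>F\<in>\<Gamma>. eventually (\<lambda>x. x \<in> U) F) \<and> (\<forall>x\<in>U. w p x \<notin> U)" if "p \<in> {i, k}" for p
    using germs_separation[OF w _ \<Gamma>] ne[OF that] unfolding w_def by blast
  then obtain U1 U2 where U1: "\<And>F. F \<in> \<Gamma> \<Longrightarrow> eventually (\<lambda>x. x \<in> U1) F" "\<And>x. x \<in> U1 \<Longrightarrow> w i x \<notin> U1"
    and U2: "\<And>F. F \<in> \<Gamma> \<Longrightarrow> eventually (\<lambda>x. x \<in> U2) F" "\<And>x. x \<in> U2 \<Longrightarrow> w k x \<notin> U2"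
    by (metis insertCI)
  \<comment> \<open>The intersection still surrounds every moved germ and is displaced by both
    words, so one commutator serves for both.\<close>
  define U where "U = U1 \<inter> U2"
  have "eventually (\<lambda>x. x \<in> U) (germ d b)" if "d \<in> D" "valid_germ d b"
    "eventually (\<lambda>x. A x \<noteq> x) (germ d b) \<or> eventually (\<lambda>x. B x \<noteq> x) (germ d b)" for d b
  proof -
    have "germ d b \<in> \<Gamma>" using that by (auto simp: \<Gamma>_def germs_def)
    then show ?thesis using eventually_conj[OF U1(1) U2(1)] by (simp add: U_def)
  qed
  from moved_germs_nbhd[OF A B this] obtain \<epsilon>' where e': "\<epsilon>' > 0"
    "\<And>x d. x \<in> unit_ival \<Longrightarrow> d \<in> D \<Longrightarrow> \<bar>x - d\<bar> < \<epsilon>' \<Longrightarrow> x \<in> U \<or> A x = x \<and> B x = x"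
    by blast
  \<comment> \<open>The quarter makes the distance 4 \<epsilon> of
    \<open>small_shifts_commute\<close> equal to the radius \<epsilon>' within which points lie in
    \<open>U\<close> or are fixed by both maps.\<close>
  define \<epsilon> where "\<epsilon> = \<epsilon>' / 4"
  have e: "\<epsilon> > 0" using e' by (simp add: \<epsilon>_def)
  obtain n \<delta> where n: "n > 0" "small_shift D \<epsilon> \<delta> (A [^]\<^bsub>ival_bij\<^esub> (n :: nat))"
    using tameD(5)[OF A e] by blast
  obtain m \<gamma> where m: "m > 0" "small_shift D \<epsilon> \<gamma> (B [^]\<^bsub>ival_bij\<^esub> (m :: nat))"
    using tameD(5)[OF B e] by blast
  define a b where "a = A [^]\<^bsub>ival_bij\<^esub> n" and "b = B [^]\<^bsub>ival_bij\<^esub> m"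
  have ab: "a \<in> Bij unit_ival" "b \<in> Bij unit_ival" using Bij_pow AB by (auto simp: a_def b_def)
  have abc: "a \<in> carrier ival_bij" "b \<in> carrier ival_bij" using ab by (simp_all add: carrier_BijGroup)
  define c where "c = (a \<otimes>\<^bsub>ival_bij\<^esub> b) \<otimes>\<^bsub>ival_bij\<^esub> inv\<^bsub>ival_bij\<^esub> (b \<otimes>\<^bsub>ival_bij\<^esub> a)"
  have c: "c \<in> Bij unit_ival" "b \<otimes>\<^bsub>ival_bij\<^esub> a \<in> Bij unit_ival"
    using abc by (simp_all add: c_def carrier_BijGroup[symmetric])
  have cba: "c \<otimes>\<^bsub>ival_bij\<^esub> (b \<otimes>\<^bsub>ival_bij\<^esub> a) = a \<otimes>\<^bsub>ival_bij\<^esub> b"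
    using abc by (simp add: c_def IB.m_assoc)
  have supp: "c x = x" if x: "x \<in> unit_ival" "x \<notin> U" for x
  proof -
    have "\<exists>y\<in>unit_ival. b (a y) = x \<and> a (b y) = x"
    proof (cases "\<forall>d\<in>D. 4 * \<epsilon> \<le> \<bar>x - d\<bar>")
      case True
      then show ?thesis
        unfolding a_def b_def by (rule small_shifts_commute[OF n(2) m(2) D x(1)])
    next
      case False
      then have "A x = x" "B x = x" using e'(2)[OF x(1)] x(2) by (auto simp: \<epsilon>_def not_le)
      then have "a x = x" "b x = x" using pow_fixed[OF AB(1) x(1)] pow_fixed[OF AB(2) x(1)]
        by (auto simp: a_def b_def)
      then show ?thesis using x(1) by (intro bexI[of _ x]) auto
    qed
    then obtain y where y: "y \<in> unit_ival" "b (a y) = x" "a (b y) = x" by blast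
    have "(b \<otimes>\<^bsub>ival_bij\<^esub> a) y = x" "(a \<otimes>\<^bsub>ival_bij\<^esub> b) y = x"
      using BijGroup_mult_apply[OF ab(1,2) y(1)] BijGroup_mult_apply[OF ab(2,1) y(1)] y by auto
    then show ?thesis using BijGroup_mult_apply[OF c y(1)] cba by simp
  qed
  have disp: "w i x \<notin> U" "w k x \<notin> U" if "x \<in> U" for x using that U1(2) U2(2) by (auto simp: U_def)
  obtain d where d: "d \<in> Bij unit_ival" "w i \<otimes>\<^bsub>ival_bij\<^esub> c = d \<otimes>\<^bsub>ival_bij\<^esub> w i"
    "c \<otimes>\<^bsub>ival_bij\<^esub> d = d \<otimes>\<^bsub>ival_bij\<^esub> c"
    using conj_displaced_commute[OF c(1) w supp disp(1)] by blast
  obtain d' where d': "d' \<in> Bij unit_ival" "w k \<otimes>\<^bsub>ival_bij\<^esub> c = d' \<otimes>\<^bsub>ival_bij\<^esub> w k"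
    "c \<otimes>\<^bsub>ival_bij\<^esub> d' = d' \<otimes>\<^bsub>ival_bij\<^esub> c"
    using conj_displaced_commute[OF c(1) w supp disp(2)] by blast
  show thesis
    by (rule that[OF ikj n(1) m(1) c(1) d(1) d'(1) cba[unfolded a_def b_def] d(2)[unfolded w_def] d(3)
        d'(2)[unfolded w_def] d'(3)])
qed

section \<open>Application to the subgroup generated by \<open>r\<close> and
  \<open>g\<close>\<close>

lemma common_tame_set:
  assumes l: "l \<in> Lambda n" and a: "\<forall>j\<in>{1..n}. a j \<in> {0..<1}"
    and N: "N > 0" "\<forall>j\<in>{1..n}. of_nat N * a j \<in> \<int> \<or> (\<forall>k>0. of_nat k * a j \<notin> \<int>)"
    and r: "r = h \<otimes>\<^bsub>ival_bij\<^esub> disjoint_rotation n a l \<otimes>\<^bsub>ival_bij\<^esub> inv\<^bsub>ival_bij\<^esub> h"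
    and h: "h \<in> IETs" and g: "g \<in> IETs"
  obtains D where "0 \<in> D" "1 \<in> D" "tame D (r [^]\<^bsub>ival_bij\<^esub> N)"
    "tame D ((inv\<^bsub>ival_bij\<^esub> g \<otimes>\<^bsub>ival_bij\<^esub> r \<otimes>\<^bsub>ival_bij\<^esub> g) [^]\<^bsub>ival_bij\<^esub> N)"
proof -
  let ?s = "disjoint_rotation n a l" and ?k = "inv\<^bsub>ival_bij\<^esub> g \<otimes>\<^bsub>ival_bij\<^esub> h"
  have hg: "h \<in> Bij unit_ival" "inv\<^bsub>ival_bij\<^esub> h \<in> Bij unit_ival"
    "g \<in> Bij unit_ival" "inv\<^bsub>ival_bij\<^esub> g \<in> Bij unit_ival"
    using IET_Bij_inverse(1) h g IET_inv_closed by blast+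
  have c: "h \<in> carrier ival_bij" "g \<in> carrier ival_bij" "?s \<in> carrier ival_bij"
    using hg rot_Bij[OF l, of a 1] disjoint_rotation_eq_rot[OF l a] by (simp_all add: carrier_BijGroup)
  obtain E1 E2 E3 E4 where E: "break_set E1 h" "break_set E2 (inv\<^bsub>ival_bij\<^esub> h)"
    "break_set E3 g" "break_set E4 (inv\<^bsub>ival_bij\<^esub> g)"
    using IET_break_set[OF h] IET_break_set[OF g] IET_break_set[OF IET_inv_closed[OF h]]
      IET_break_set[OF IET_inv_closed[OF g]] by blast
  have k: "?k \<in> Bij unit_ival" using IB.m_closed[of "inv\<^bsub>ival_bij\<^esub> g" h] hg by (simp add: carrier_BijGroup)
  have ik: "inv\<^bsub>ival_bij\<^esub> ?k = inv\<^bsub>ival_bij\<^esub> h \<otimes>\<^bsub>ival_bij\<^esub> g"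
    using c by (simp add: IB.inv_mult_group)
  obtain E5 where E5: "break_set E5 ?k" using break_set_comp[OF hg(4) E(4) hg(1) E(1)] by blast
  obtain E6 where E6: "break_set E6 (inv\<^bsub>ival_bij\<^esub> ?k)"
    using break_set_comp[OF hg(2) E(2) hg(3) E(3)] unfolding ik by blast
  obtain D1 where D1: "tame D1 (r [^]\<^bsub>ival_bij\<^esub> N)"
    using tame_conj_disjoint_rotation[OF l a N hg(1) E(1,2)] r by blast
  \<comment> \<open>The conjugate of \<open>r\<close> is again a conjugate of the rotation, now by
    g^-1 h, so the same tameness result covers it.\<close>
  have "inv\<^bsub>ival_bij\<^esub> g \<otimes>\<^bsub>ival_bij\<^esub> r \<otimes>\<^bsub>ival_bij\<^esub> g = ?k \<otimes>\<^bsub>ival_bij\<^esub> ?s \<otimes>\<^bsub>ival_bij\<^esub> inv\<^bsub>ival_bij\<^esub> ?k"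
    using c unfolding ik r by (simp add: IB.m_assoc)
  then obtain D2 where D2: "tame D2 ((inv\<^bsub>ival_bij\<^esub> g \<otimes>\<^bsub>ival_bij\<^esub> r \<otimes>\<^bsub>ival_bij\<^esub> g) [^]\<^bsub>ival_bij\<^esub> N)"
    using tame_conj_disjoint_rotation[OF l a N k E5 E6] by auto
  have fin: "finite D1" "finite D2"
    using break_set_finite[OF tameD(2)[OF D1]] break_set_finite[OF tameD(2)[OF D2]] .
  show thesis
  proof (rule that[of "D1 \<union> D2 \<union> {0, 1}"])
    show "tame (D1 \<union> D2 \<union> {0, 1}) (r [^]\<^bsub>ival_bij\<^esub> N)"
      by (rule tame_mono[OF D1]) (use fin in auto)
    show "tame (D1 \<union> D2 \<union> {0, 1})
        ((inv\<^bsub>ival_bij\<^esub> g \<otimes>\<^bsub>ival_bij\<^esub> r \<otimes>\<^bsub>ival_bij\<^esub> g) [^]\<^bsub>ival_bij\<^esub> N)"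
      by (rule tame_mono[OF D2]) (use fin in auto)
  qed auto
qed

theorem theorem1p3:
  fixes r g s :: "real \<Rightarrow> real"
  assumes "r \<in> carrier IET_group"
    and "s \<in> disjoint_rotations"
    and "conjugate_in IET_group r s"
    and "g \<in> carrier IET_group"
  shows "\<not> (IET_group\<lparr>carrier := generate IET_group {r, g}\<rparr> \<cong> free_group {0, 1 :: nat})"
proof
  let ?F = "free_group {0, 1 :: nat}"
  assume iso: "IET_group\<lparr>carrier := generate IET_group {r, g}\<rparr> \<cong> ?F"
  have rg: "r \<in> IETs" "g \<in> IETs" using assms(1,4) by (simp_all add: IET_group_simps)
  then have c: "r \<in> carrier ival_bij" "g \<in> carrier ival_bij" using IETs_subset by blast+
  define H where "H = generate ival_bij {r, g}"
  define K where "K = ival_bij\<lparr>carrier := H\<rparr>"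
  have "IET_group\<lparr>carrier := generate IET_group {r, g}\<rparr> = K"
    using rg generate_IET_group[of "{r, g}"] by (simp add: K_def H_def IET_group_def)
  with iso obtain \<phi> where \<phi>: "\<phi> \<in> hom K ?F" "bij_betw \<phi> (carrier K) (carrier ?F)"
    by (auto simp: is_iso_def iso_def)
  have H: "subgroup H ival_bij" unfolding H_def using c by (intro IB.generate_is_subgroup) auto
  interpret H: subgroup H ival_bij by (rule H)
  have K: "group K" unfolding K_def by (rule IB.subgroup_imp_group[OF H])
  have rgH: "r \<in> H" "g \<in> H" by (auto simp: H_def intro: generate.incl)
  interpret K: csa_group K
    by (rule csa_group_mon[OF csa_free_group K \<phi>(1)]) (use \<phi>(2) in \<open>simp add: bij_betw_def\<close>)
  have Kmult: "x \<otimes>\<^bsub>K\<^esub> y = x \<otimes>\<^bsub>ival_bij\<^esub> y" for x y by (simp add: K_def)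
  have Kpow: "x [^]\<^bsub>K\<^esub> k = x [^]\<^bsub>ival_bij\<^esub> k" for x and k :: nat
    unfolding K_def by (rule IB.nat_pow_consistent[symmetric])
  have Kcarr: "carrier K = H" by (simp add: K_def)

  obtain n a l where s: "s = disjoint_rotation n a l"
    and a: "\<forall>j\<in>{1..n}. a j \<in> {0..<1}" and l: "l \<in> Lambda n"
    using assms(2) by (auto simp: disjoint_rotations_def)
  obtain h where h: "h \<in> IETs" and r: "r = h \<otimes>\<^bsub>ival_bij\<^esub> s \<otimes>\<^bsub>ival_bij\<^esub> inv\<^bsub>ival_bij\<^esub> h"
    using assms(3) inv_IET_group by (auto simp: conjugate_in_def IET_group_simps)
  obtain N where N: "N > 0" "\<forall>j\<in>{1..n}. of_nat N * a j \<in> \<int> \<or> (\<forall>k>0. of_nat k * a j \<notin> \<int>)"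
    using ex_common_period[of n a] by blast
  define y where "y = inv\<^bsub>ival_bij\<^esub> g \<otimes>\<^bsub>ival_bij\<^esub> r \<otimes>\<^bsub>ival_bij\<^esub> g"
  obtain D where D: "0 \<in> D" "1 \<in> D" "tame D (r [^]\<^bsub>ival_bij\<^esub> N)" "tame D (y [^]\<^bsub>ival_bij\<^esub> N)"
    using common_tame_set[OF l a N r[unfolded s] h rg(2)] unfolding y_def by blast
  have yH: "y \<in> H" unfolding y_def by (intro H.m_closed H.m_inv_closed rgH IB.is_group)
  have gy: "g \<otimes>\<^bsub>ival_bij\<^esub> y = r \<otimes>\<^bsub>ival_bij\<^esub> g"
    using c by (simp add: y_def IB.m_assoc[symmetric])
  define A B where "A = r [^]\<^bsub>ival_bij\<^esub> N" and "B = y [^]\<^bsub>ival_bij\<^esub> N"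
  have AB: "A \<in> H" "B \<in> H" unfolding A_def B_def using H.nat_pow_mem IB.is_group rgH yH by blast+
  obtain i k j m p :: nat and x d d' where pos: "i < k" "0 < j" "0 < m" "0 < p"
    and xB: "x \<in> Bij unit_ival" "d \<in> Bij unit_ival" "d' \<in> Bij unit_ival"
    and x: "x \<otimes>\<^bsub>ival_bij\<^esub> (B [^]\<^bsub>ival_bij\<^esub> p \<otimes>\<^bsub>ival_bij\<^esub> A [^]\<^bsub>ival_bij\<^esub> m) = A [^]\<^bsub>ival_bij\<^esub> m \<otimes>\<^bsub>ival_bij\<^esub> B [^]\<^bsub>ival_bij\<^esub> p"
    and d: "(A [^]\<^bsub>ival_bij\<^esub> i \<otimes>\<^bsub>ival_bij\<^esub> B [^]\<^bsub>ival_bij\<^esub> j) \<otimes>\<^bsub>ival_bij\<^esub> x = d \<otimes>\<^bsub>ival_bij\<^esub> (A [^]\<^bsub>ival_bij\<^esub> i \<otimes>\<^bsub>ival_bij\<^esub> B [^]\<^bsub>ival_bij\<^esub> j)"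
      "x \<otimes>\<^bsub>ival_bij\<^esub> d = d \<otimes>\<^bsub>ival_bij\<^esub> x"
    and d': "(A [^]\<^bsub>ival_bij\<^esub> k \<otimes>\<^bsub>ival_bij\<^esub> B [^]\<^bsub>ival_bij\<^esub> j) \<otimes>\<^bsub>ival_bij\<^esub> x = d' \<otimes>\<^bsub>ival_bij\<^esub> (A [^]\<^bsub>ival_bij\<^esub> k \<otimes>\<^bsub>ival_bij\<^esub> B [^]\<^bsub>ival_bij\<^esub> j)"
      "x \<otimes>\<^bsub>ival_bij\<^esub> d' = d' \<otimes>\<^bsub>ival_bij\<^esub> x"
    using tame_commutator_law[OF D(3,4,1,2)] unfolding A_def B_def by metis
  have pw: "A [^]\<^bsub>ival_bij\<^esub> q \<in> H" "B [^]\<^bsub>ival_bij\<^esub> q \<in> H" for q :: nat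
    using H.nat_pow_mem IB.is_group AB by blast+
  note left_factor = IB.subgroup_left_factor_mem[OF H, unfolded carrier_BijGroup]
  \<comment> \<open>The law exhibits \<open>x\<close> as a left factor of an element of
    \<open>H\<close> whose right factor is in \<open>H\<close>; the conjugates are treated
    alike.\<close>
  have xH: "x \<in> H"
    by (rule left_factor[OF xB(1) H.m_closed[OF pw(2)[of p] pw(1)[of m]]], unfold x)
       (intro H.m_closed pw)
  have dH: "d \<in> H" "d' \<in> H"
    using left_factor[OF xB(2) H.m_closed[OF pw(1)[of i] pw(2)[of j]], folded d(1)]
      left_factor[OF xB(3) H.m_closed[OF pw(1)[of k] pw(2)[of j]], folded d'(1)]
      H.m_closed[OF H.m_closed[OF pw(1) pw(2)] xH] by blast+
  have "r \<otimes>\<^bsub>ival_bij\<^esub> g = g \<otimes>\<^bsub>ival_bij\<^esub> r"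
    by (rule K.commutator_law_imp_commute[of r g y x d d' A N B p m _ i j _ k,
          unfolded Kmult Kpow Kcarr, OF rgH yH xH dH gy A_def B_def x refl refl d d' N(1) pos(3,4,2,1)])
  then have comm: "u \<otimes>\<^bsub>K\<^esub> v = v \<otimes>\<^bsub>K\<^esub> u" if "u \<in> carrier K" "v \<in> carrier K" for u v
    using IB.generate_pair_commute[OF c] that by (simp add: K_def H_def)
  \<comment> \<open>The two generators multiplied in either order give distinct reduced words,
    against commutativity of \<open>H\<close>.\<close>
  have "[(0, True)] \<in> carrier ?F" "[(1, True)] \<in> carrier ?F" by (auto simp: free_group_def)
  then obtain u v where "u \<in> carrier K" "\<phi> u = [(0, True)]" "v \<in> carrier K" "\<phi> v = [(1, True)]"
    using \<phi>(2) by (metis bij_betw_def imageE)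
  then have "[(0, True)] \<otimes>\<^bsub>?F\<^esub> [(1, True)] = [(1, True)] \<otimes>\<^bsub>?F\<^esub> [(0, True)]"
    using comm[of u v] hom_mult[OF \<phi>(1), of u v] hom_mult[OF \<phi>(1), of v u] by simp
  then show False by (simp add: free_group_def opp_def)
qed

end
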